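(* Let $g(z)=\sum_{n=0}^\infty b_nz^n$ be analytic in the unit disc $\mathbb{D}$ with $b_n\ge0$ for all $n\in\mathbb{N}\cup\{0\}$. If $\alpha>-1$, then the following statements are equivalent: (1) The operator $\mathcal{H}_g:\mathcal{B}_{\log^\alpha}\to\mathcal{B}_{\log^{\alpha+1}}$ is bounded. (2) $g\in\mathcal{B}$. (3) $\displaystyle\sum_{n=1}^N nb_n\log^{\alpha+1}(n+1)=O\left(N\log^{\alpha+1}N\right)$ as $N\to\infty$. (4) $\displaystyle\sum_{n=1}^N nb_n=O(N)$ as $N\to\infty$.
   Context: $\mathbb{D}$ is the open unit disc of $\mathbb{C}$ and $H(\mathbb{D})$ is the space of all analytic functions in $\mathbb{D}$. For $g\in H(\mathbb{D})$ the generalized Hilbert operator is $\mathcal{H}_g(f)(z)=\int_0^1 f(t)g'(tz)\,dt$, $z\in\mathbb{D}$, for $f\in H(\mathbb{D})$ with $\int_0^1|f(t)|\,dt<\infty$ (this holds for all $f\in\mathcal{B}_{\log^\alpha}$). For $\alpha\in\mathbb{R}$, the logarithmically weighted Bloch space $\mathcal{B}_{\log^\alpha}$ is the space of $f\in H(\mathbb{D})$ with $\|f\|_{\mathcal{B}_{\log^\alpha}}=|f(0)|+\sup_{z\in\mathbb{D}}(1-|z|^2)\left(\log\frac{e}{1-|z|^2}\right)^{-\alpha}|f'(z)|<\infty$. $\mathcal{B}=\mathcal{B}_{\log^0}$ is the Bloch space. Here $\log^\gamma x=(\log x)^\gamma$. *)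

theory Defs
  imports "HOL-Complex_Analysis.Complex_Analysis" "HOL-Library.Landau_Symbols"
begin

text \<open>
  The unit disc is \<open>ball 0 1 :: complex set\<close>.  Functions on the disc are total functions
  of which only the values on the disc matter.
\<close>

definition bloch_quotient :: "real \<Rightarrow> (complex \<Rightarrow> complex) \<Rightarrow> complex \<Rightarrow> real" where
  "bloch_quotient \<alpha> f z =
     (1 - (norm z)\<^sup>2) * ln (exp 1 / (1 - (norm z)\<^sup>2)) powr (- \<alpha>) * norm (deriv f z)"

text \<open>
  Finiteness of the norm is the boundedness condition in \<open>log_bloch\<close>; the real supremum in
  \<open>log_bloch_norm\<close> is meaningful only for members of that space.
\<close>

definition log_bloch :: "real \<Rightarrow> (complex \<Rightarrow> complex) set" where
  "log_bloch \<alpha> =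
     {f. f holomorphic_on ball 0 1 \<and> bdd_above (bloch_quotient \<alpha> f ` ball 0 1)}"

definition log_bloch_norm :: "real \<Rightarrow> (complex \<Rightarrow> complex) \<Rightarrow> real" where
  "log_bloch_norm \<alpha> f = norm (f 0) + (SUP z\<in>ball 0 1. bloch_quotient \<alpha> f z)"

abbreviation bloch :: "(complex \<Rightarrow> complex) set" where
  "bloch \<equiv> log_bloch 0"

text \<open>
  The integral omits the endpoint \<open>t = 1\<close>, where \<open>f\<close> carries no information.  It is
  meant for \<open>f\<close> holomorphic on the disc and absolutely integrable over the radius, which
  holds for every member of a space \<open>log_bloch \<alpha>\<close>.
\<close>

definition hilbert_op :: "(complex \<Rightarrow> complex) \<Rightarrow> (complex \<Rightarrow> complex) \<Rightarrow> complex \<Rightarrow> complex" where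
  "hilbert_op g f z =
     (LINT t:{0..<1}|lborel. f (complex_of_real t) * deriv g (complex_of_real t * z))"

definition bounded_operator_log_bloch ::
    "real \<Rightarrow> real \<Rightarrow> ((complex \<Rightarrow> complex) \<Rightarrow> complex \<Rightarrow> complex) \<Rightarrow> bool" where
  "bounded_operator_log_bloch \<alpha> \<beta> T \<longleftrightarrow>
     (\<forall>f\<in>log_bloch \<alpha>. T f \<in> log_bloch \<beta>) \<and>
     (\<exists>C. \<forall>f\<in>log_bloch \<alpha>. log_bloch_norm \<beta> (T f) \<le> C * log_bloch_norm \<alpha> f)"

end

theory Submission
  imports Defs
begin

text \<open>
  Put \<open>\<beta> = \<alpha> + 1 > 0\<close> and \<open>d\<^sub>n = (n + 1) b\<^sub>n\<^sub>+\<^sub>1\<close>, so that \<open>g' z = \<Sum> d\<^sub>n z\<^sup>n\<close>.  The equivalence of (2) and (4) is the usual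
  comparison between \<open>\<Sum> d\<^sub>n r\<^sup>n\<close> and partial sums of \<open>d\<close> for nonnegative coefficients; (3) and (4)
  differ only by a slowly varying weight.  Integrating the series of \<open>g'\<close> termwise turns the
  operator into \<open>f \<mapsto> \<Sum> d\<^sub>n m\<^sub>n z\<^sup>n\<close> with moments \<open>m\<^sub>n = \<integral> t\<^sup>n f t\<close> over \<open>[0, 1)\<close>.  Members of the
  \<open>\<alpha>\<close>-space grow along the radius at most like \<open>(ln (e / (1 - t))) powr \<beta>\<close>, so their moments are
  \<open>O((ln n) powr \<beta> / n)\<close>; the function \<open>(ln (e / (1 - z))) powr \<beta>\<close> attains this order with positive
  moments.  The upper bound gives (4) \<open>\<Longrightarrow>\<close> (1), and that function gives (1) \<open>\<Longrightarrow>\<close> (3).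
\<close>

section \<open>The logarithmic weight\<close>

text \<open>For \<open>t = (norm z)\<^sup>2\<close> this is the logarithm ln (e / (1 - t)) of the
  Bloch weight. The difference form turns quotients of values of 1 - t into sums.\<close>

definition logw :: "real \<Rightarrow> real" where
  "logw t = 1 - ln (1 - t)"

lemma logw_ge_1: "0 \<le> t \<Longrightarrow> t < 1 \<Longrightarrow> 1 \<le> logw t"
  by (simp add: logw_def ln_le_zero_iff)

lemma logw_mono: "s \<le> t \<Longrightarrow> t < 1 \<Longrightarrow> logw s \<le> logw t"
  by (simp add: logw_def)

lemma bloch_quotient_eq_logw:
  assumes "z \<in> ball 0 1"
  shows "bloch_quotient \<alpha> f z =
    (1 - (norm z)\<^sup>2) * logw ((norm z)\<^sup>2) powr (- \<alpha>) * norm (deriv f z)"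
proof -
  have "(norm z)\<^sup>2 < 1"
    using assms by (simp add: power_less_one_iff)
  then show ?thesis
    by (simp add: bloch_quotient_def logw_def ln_div)
qed

lemma bloch_quotient_nonneg:
  assumes "z \<in> ball 0 1"
  shows "bloch_quotient \<alpha> f z \<ge> 0"
proof -
  have "(norm z)\<^sup>2 \<le> 1"
    using assms by (simp add: power_le_one)
  then show ?thesis
    by (simp add: bloch_quotient_def)
qed

lemma logw_square_le: "0 \<le> r \<Longrightarrow> r < 1 \<Longrightarrow> logw (r\<^sup>2) \<le> logw r"
  by (intro logw_mono) (auto simp: power2_eq_square mult_left_le)

text \<open>Since 1 - r^2 = (1 - r) (1 + r) and ln (1 + r) \<le> 1, squaring the argument lowers
  \<open>logw\<close> by at most 1, which \<open>logw (r\<^sup>2)\<close> \<ge> 1 absorbs. This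
  allows the Bloch weight to be evaluated at |z| instead of |z|^2.\<close>

lemma logw_le_square:
  assumes "0 \<le> r" "r < 1"
  shows "logw r \<le> 2 * logw (r\<^sup>2)"
proof -
  have r2: "r\<^sup>2 < 1"
    using assms by (simp add: power_less_one_iff)
  have "1 - r\<^sup>2 = (1 - r) * (1 + r)"
    by (simp add: power2_eq_square algebra_simps)
  then have "ln (1 - r\<^sup>2) = ln (1 - r) + ln (1 + r)"
    using assms by (simp add: ln_mult)
  moreover have "ln (1 + r) \<le> 1"
    using ln_add_one_self_le_self [of r] assms by linarith
  ultimately have "logw r \<le> logw (r\<^sup>2) + 1"
    by (simp add: logw_def)
  also have "\<dots> \<le> 2 * logw (r\<^sup>2)"
    using logw_ge_1 [of "r\<^sup>2"] r2 by simp
  finally show ?thesis .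
qed

text \<open>Follows from \<open>ln y \<le> y - 1\<close> at \<open>y = x powr (1 / k)\<close> with \<open>k = 2 * \<beta> + 1\<close>.\<close>

lemma one_plus_ln_powr_le_sqrt:
  assumes "\<beta> > 0"
  obtains C where "C \<ge> 1" "\<And>x. x \<ge> 1 \<Longrightarrow> (1 + ln x) powr \<beta> \<le> C * sqrt x"
proof -
  define k where "k = 2 * \<beta> + 1"
  have k: "k > 1" "\<beta> / k \<le> 1 / 2"
    using assms by (auto simp: k_def field_simps)
  have "(1 + ln x) powr \<beta> \<le> k powr \<beta> * sqrt x" if x: "x \<ge> 1" for x
  proof -
    have "ln (x powr (1 / k)) \<le> x powr (1 / k) - 1"
      using x by (intro ln_le_minus_one) auto
    then have "1 + ln x \<le> k * x powr (1 / k)"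
      using x k by (simp add: ln_powr field_simps)
    then have "(1 + ln x) powr \<beta> \<le> (k * x powr (1 / k)) powr \<beta>"
      using x assms by (intro powr_mono2) auto
    also have "\<dots> = k powr \<beta> * x powr (\<beta> / k)"
      using k x by (simp add: powr_mult powr_powr)
    also have "\<dots> \<le> k powr \<beta> * x powr (1 / 2)"
      using k x by (intro mult_left_mono powr_mono) auto
    finally show ?thesis
      using x by (simp add: powr_half_sqrt)
  qed
  moreover have "k powr \<beta> \<ge> 1"
    using k assms by (simp add: ge_one_powr_ge_zero)
  ultimately show ?thesis
    using that by blast
qed

text \<open>With u = (1 - \<rho>) / (1 - t), \<open>logw t\<close> = \<open>logw \<rho>\<close> + ln
  u, and \<open>logw \<rho>\<close> \<ge> 1 bounds this sum by the product of
  \<open>logw \<rho>\<close> and 1 + ln u. The result is a majorant integrable up to 1 that carries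
  the size of the weight at \<rho>.\<close>

lemma logw_powr_le_scaled:
  assumes C: "\<And>x. x \<ge> 1 \<Longrightarrow> (1 + ln x) powr \<beta> \<le> C * sqrt x"
    and "\<beta> > 0" "0 \<le> \<rho>" "\<rho> \<le> t" "t < 1"
  shows "logw t powr \<beta> \<le> C * logw \<rho> powr \<beta> * sqrt ((1 - \<rho>) / (1 - t))"
proof -
  define u where "u = (1 - \<rho>) / (1 - t)"
  have u: "u \<ge> 1"
    using assms by (simp add: u_def)
  have L: "logw \<rho> \<ge> 1"
    using assms by (intro logw_ge_1) auto
  have "logw t = logw \<rho> + ln u"
    using assms by (simp add: logw_def u_def ln_div)
  also have "\<dots> \<le> logw \<rho> + logw \<rho> * ln u"
    using mult_right_mono [OF L, of "ln u"] u by simp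
  finally have "logw t \<le> logw \<rho> * (1 + ln u)"
    by (simp add: algebra_simps)
  then have "logw t powr \<beta> \<le> (logw \<rho> * (1 + ln u)) powr \<beta>"
    using logw_ge_1 [of t] assms by (intro powr_mono2) auto
  also have "\<dots> = logw \<rho> powr \<beta> * (1 + ln u) powr \<beta>"
    using L u by (simp add: powr_mult)
  also have "\<dots> \<le> logw \<rho> powr \<beta> * (C * sqrt u)"
    using C [OF u] by (intro mult_left_mono) auto
  finally show ?thesis
    by (simp add: u_def mult_ac)
qed

text \<open>The integrand blows up at 1, so the improper form of the fundamental theorem is applied
  to the antiderivative -2 sqrt (1 - t), whose continuity supplies both endpoint limits.\<close>

lemma inverse_sqrt_integral:
  fixes \<rho> :: real
  assumes "\<rho> < 1"
  shows "set_integrable lborel {\<rho><..<1} (\<lambda>t. 1 / sqrt (1 - t))"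
    and "(LBINT t:{\<rho><..<1}. 1 / sqrt (1 - t)) = 2 * sqrt (1 - \<rho>)"
proof -
  define F where "F = (\<lambda>t::real. - 2 * sqrt (1 - t))"
  have deriv: "(F has_real_derivative 1 / sqrt (1 - t)) (at t)" if "t < 1" for t
    unfolding F_def using that
    by (auto intro!: derivative_eq_intros simp: divide_simps)
  have cont: "isCont (\<lambda>t. 1 / sqrt (1 - t)) t" if "t < 1" for t :: real
    using that by (intro continuous_intros) auto
  have contF: "isCont F t" for t
    unfolding F_def by (intro continuous_intros)
  have 1: "((F \<circ> real_of_ereal) \<longlongrightarrow> - 2 * sqrt (1 - \<rho>)) (at_right (ereal \<rho>))"
    using contF [of \<rho>] by (simp add: ereal_tendsto_simps isCont_def F_def filterlim_at_split)
  have 2: "((F \<circ> real_of_ereal) \<longlongrightarrow> 0) (at_left (ereal 1))"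
    using contF [of 1] by (simp add: ereal_tendsto_simps isCont_def F_def filterlim_at_split)
  have "ereal \<rho> < ereal 1"
    using assms by simp
  note FTC = interval_integral_FTC_nonneg [of "ereal \<rho>" "ereal 1" F "\<lambda>t. 1 / sqrt (1 - t)", OF this _ _ _ 1 2]
  have "set_integrable lborel (einterval (ereal \<rho>) (ereal 1)) (\<lambda>t. 1 / sqrt (1 - t))"
    using deriv cont by (intro FTC) (auto simp del: less_divide_eq_1_pos)
  then show "set_integrable lborel {\<rho><..<1} (\<lambda>t. 1 / sqrt (1 - t))"
    by simp
  have "(LBINT t=ereal \<rho>..ereal 1. 1 / sqrt (1 - t)) = 0 - (- 2 * sqrt (1 - \<rho>))"
    using deriv cont by (intro FTC) auto
  then show "(LBINT t:{\<rho><..<1}. 1 / sqrt (1 - t)) = 2 * sqrt (1 - \<rho>)"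
    using assms by (simp add: interval_lebesgue_integral_def)
qed

text \<open>The exponent may have either sign: the bound of \<open>a\<close> by \<open>c * b\<close>
  serves nonnegative \<alpha>, the bound of \<open>b\<close> by \<open>c * a\<close> serves negative
  \<alpha>.\<close>

lemma powr_le_comparable:
  fixes a b c \<alpha> :: real
  assumes "0 < a" "0 < b" "1 \<le> c" "a \<le> c * b" "b \<le> c * a"
  shows "a powr \<alpha> \<le> c powr \<bar>\<alpha>\<bar> * b powr \<alpha>"
proof (cases "\<alpha> \<ge> 0")
  case True
  then have "a powr \<alpha> \<le> (c * b) powr \<alpha>"
    using assms by (intro powr_mono2) auto
  then show ?thesis
    using assms True by (simp add: powr_mult)
next
  case False
  then have "a powr \<alpha> \<le> (b / c) powr \<alpha>"
    using assms by (intro powr_mono2') (auto simp: field_simps)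
  then show ?thesis
    using assms False by (simp add: powr_divide powr_minus field_simps)
qed

lemma logw_square_powr_le:
  assumes "0 \<le> r" "r < 1"
  shows "logw (r\<^sup>2) powr \<alpha> \<le> 2 powr \<bar>\<alpha>\<bar> * logw r powr \<alpha>"
proof -
  have "r\<^sup>2 < 1"
    using assms by (simp add: power_less_one_iff)
  then have "logw (r\<^sup>2) \<ge> 1" "logw r \<ge> 1"
    using assms by (auto intro: logw_ge_1)
  then show ?thesis
    using logw_square_le [OF assms] logw_le_square [OF assms] by (intro powr_le_comparable) auto
qed

section \<open>Moments of powers of the logarithmic weight\<close>

lemma logw_measurable [measurable]: "logw \<in> borel_measurable borel"
  unfolding logw_def by measurable

text \<open>The interval is cut at \<rho> = 1 - 1 / (n + 1). Left of \<rho> the weight is at most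
  its value there, and the integral of t^n is at most 1 / (n + 1). Right of \<rho>, t^n \<le> 1 and
  the scaled bound integrates to a multiple of the length 1 - \<rho>.\<close>

lemma logw_moment_upper:
  fixes \<beta> :: real
  assumes "\<beta> > 0"
  obtains C where "C > 0"
    "\<And>n. set_integrable lborel {0..<1} (\<lambda>t. t ^ n * logw t powr \<beta>)"
    "\<And>n. (LBINT t:{0..<1}. t ^ n * logw t powr \<beta>) \<le> C * (1 + ln (real (n + 1))) powr \<beta> / real (n + 1)"
proof -
  obtain C where C: "C \<ge> 1" "\<And>x. x \<ge> 1 \<Longrightarrow> (1 + ln x) powr \<beta> \<le> C * sqrt x"
    using one_plus_ln_powr_le_sqrt [OF assms] by blast
  have main: "set_integrable lborel {0..<1} (\<lambda>t. t ^ n * logw t powr \<beta>) \<and>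
    (LBINT t:{0..<1}. t ^ n * logw t powr \<beta>) \<le> (1 + 2 * C) * (1 + ln (real (n + 1))) powr \<beta> / real (n + 1)" for n
  proof -
    define \<rho> where "\<rho> = 1 - 1 / real (n + 1)"
    have \<rho>: "0 \<le> \<rho>" "\<rho> < 1" "1 - \<rho> = 1 / real (n + 1)"
      by (auto simp: \<rho>_def)
    define A where "A = logw \<rho> powr \<beta>"
    have A: "A = (1 + ln (real (n + 1))) powr \<beta>"
      unfolding A_def logw_def \<rho>(3) by (simp add: ln_div)
    \<comment> \<open>An explicit majorant of both pieces. Its first term is kept on all of [0, 1],
      so that its integral is exactly \<open>A / (n + 1)\<close>; the factor
      \<open>sqrt (1 - \<rho>)\<close> of the second meets the same factor from the
      integral.\<close>
    define G where "G = (\<lambda>t. A * (t ^ n * indicator {0..1} t) +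
      C * A * sqrt (1 - \<rho>) * (indicator {\<rho><..<1} t *\<^sub>R (1 / sqrt (1 - t))))"
    have i1: "integrable lborel (\<lambda>t::real. t ^ n * indicator {0..1} t)"
      using borel_integrable_atLeastAtMost' [of 0 1 "\<lambda>t::real. t ^ n"]
      by (simp add: set_integrable_def mult.commute continuous_on_power)
    have i2: "integrable lborel (\<lambda>t. indicator {\<rho><..<1} t *\<^sub>R (1 / sqrt (1 - t)))"
      using inverse_sqrt_integral(1) [OF \<rho>(2)] by (simp add: set_integrable_def)
    have sq: "sqrt (1 - \<rho>) * sqrt (1 - \<rho>) = 1 / real (n + 1)"
      using \<rho> by simp
    have G_int: "integrable lborel G"
      unfolding G_def using i1 i2 by (intro Bochner_Integration.integrable_add integrable_mult_right) auto
    have "integral\<^sup>L lborel G = A * (1 / real (n + 1)) + C * A * sqrt (1 - \<rho>) * (2 * sqrt (1 - \<rho>))"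
    proof -
      have "integral\<^sup>L lborel G = A * (LBINT t. t ^ n * indicator {0..1} t) +
          C * A * sqrt (1 - \<rho>) * (LBINT t. indicator {\<rho><..<1} t *\<^sub>R (1 / sqrt (1 - t)))"
        unfolding G_def
        by (subst Bochner_Integration.integral_add [OF integrable_mult_right [OF i1] integrable_mult_right [OF i2]])
          (simp only: integral_mult_right_zero)
      then show ?thesis
        using integral_power [of 0 1 n] inverse_sqrt_integral(2) [OF \<rho>(2)]
        by (simp add: set_lebesgue_integral_def)
    qed
    also have "A * (1 / real (n + 1)) + C * A * sqrt (1 - \<rho>) * (2 * sqrt (1 - \<rho>)) =
        A * (1 / real (n + 1)) + 2 * C * A * (sqrt (1 - \<rho>) * sqrt (1 - \<rho>))"
      by (simp only: mult_ac)
    also have "\<dots> = A * (1 / real (n + 1)) + 2 * C * A * (1 / real (n + 1))"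
      by (simp only: sq)
    also have "\<dots> = (1 + 2 * C) * A / real (n + 1)"
      by (simp add: algebra_simps add_divide_distrib)
    finally have G_val: "integral\<^sup>L lborel G = (1 + 2 * C) * A / real (n + 1)" .
    have bound: "indicator {0..<1} t *\<^sub>R (t ^ n * logw t powr \<beta>) \<le> G t" for t
    proof (cases "t \<in> {0..<1}")
      case False
      then show ?thesis
        using C(1) \<rho> by (auto simp: G_def A_def indicator_def)
    next
      case t: True
      show ?thesis
      proof (cases "t \<le> \<rho>")
        case True
        have "logw t powr \<beta> \<le> A"
          unfolding A_def using True t \<rho> assms logw_ge_1 [of t]
          by (intro powr_mono2 logw_mono) auto
        then have "t ^ n * logw t powr \<beta> \<le> t ^ n * A"
          using t by (intro mult_left_mono) auto
        moreover have "G t = t ^ n * A"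
          using t True by (simp add: G_def)
        ultimately show ?thesis
          using t by simp
      next
        case False
        have "t ^ n * logw t powr \<beta> \<le> 1 * (C * A * sqrt ((1 - \<rho>) / (1 - t)))"
        proof (rule mult_mono)
          show "logw t powr \<beta> \<le> C * A * sqrt ((1 - \<rho>) / (1 - t))"
            unfolding A_def using False t \<rho> assms by (intro logw_powr_le_scaled [OF C(2)]) auto
        qed (use t in \<open>auto intro: power_le_one\<close>)
        also have "\<dots> \<le> A * t ^ n + C * A * sqrt (1 - \<rho>) * (1 / sqrt (1 - t))"
          using t by (simp add: A_def real_sqrt_divide)
        also have "\<dots> = G t"
          using t False by (simp add: G_def)
        finally show ?thesis
          using t by simp
      qed
    qed
    have int: "integrable lborel (\<lambda>t. indicator {0..<1} t *\<^sub>R (t ^ n * logw t powr \<beta>))"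
    proof (rule Bochner_Integration.integrable_bound [OF G_int])
      show "AE t in lborel. norm (indicator {0..<1} t *\<^sub>R (t ^ n * logw t powr \<beta>)) \<le> norm (G t)"
      proof (rule AE_I2)
        fix t :: real
        have "0 \<le> indicator {0..<1} t *\<^sub>R (t ^ n * logw t powr \<beta>)"
          by (simp add: indicator_def)
        then show "norm (indicator {0..<1} t *\<^sub>R (t ^ n * logw t powr \<beta>)) \<le> norm (G t)"
          using bound [of t] by simp
      qed
    qed measurable
    have "(LBINT t:{0..<1}. t ^ n * logw t powr \<beta>) \<le> integral\<^sup>L lborel G"
      unfolding set_lebesgue_integral_def using int G_int bound by (intro integral_mono)
    with int show ?thesis
      by (simp add: set_integrable_def G_val A)
  qed
  show ?thesis
    using C(1) main by (intro that [of "1 + 2 * C"]) auto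
qed

text \<open>Only [\<rho>, 1] with \<rho> = 1 - 1 / (n + 1) is kept. There the weight is at least its
  value at \<rho>, and \<rho>^(n + 1) \<le> 1 / e \<le> 1 / 2 leaves at least half of the full
  integral of t^n.\<close>

lemma logw_moment_lower:
  fixes \<beta> :: real
  assumes "\<beta> > 0"
  shows "(1 + ln (real (n + 1))) powr \<beta> / (2 * real (n + 1)) \<le> (LBINT t:{0..<1}. t ^ n * logw t powr \<beta>)"
proof -
  define \<rho> where "\<rho> = 1 - 1 / real (n + 1)"
  have \<rho>: "0 \<le> \<rho>" "\<rho> < 1" "1 - \<rho> = 1 / real (n + 1)"
    by (auto simp: \<rho>_def)
  define A where "A = logw \<rho> powr \<beta>"
  have A: "A = (1 + ln (real (n + 1))) powr \<beta>"
    unfolding A_def logw_def \<rho>(3) by (simp add: ln_div)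
  have "\<rho> \<le> exp (- (1 / real (n + 1)))"
    using exp_ge_add_one_self [of "- (1 / real (n + 1))"] by (simp add: \<rho>_def)
  then have "\<rho> ^ Suc n \<le> exp (- (1 / real (n + 1))) ^ Suc n"
    using \<rho> by (intro power_mono) auto
  also have "\<dots> = exp (- 1)"
    by (simp add: exp_of_nat_mult [symmetric] field_simps del: power_Suc)
  also have "\<dots> \<le> 1 / 2"
    using exp_ge_add_one_self [of "1::real"] by (simp add: exp_minus field_simps)
  finally have half: "\<rho> ^ Suc n \<le> 1 / 2" .
  have "A * (1 / 2) / real (n + 1) \<le> A * (1 - \<rho> ^ Suc n) / real (n + 1)"
    using half by (intro divide_right_mono mult_left_mono) (auto simp: A_def)
  also have "\<dots> = (LBINT t. A * (t ^ n * indicator {\<rho>..1} t))"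
    using integral_power [of \<rho> 1 n] \<rho> by simp
  also have "\<dots> \<le> (LBINT t. indicator {0..<1} t *\<^sub>R (t ^ n * logw t powr \<beta>))"
  proof (rule integral_mono_AE)
    show "integrable lborel (\<lambda>t. A * (t ^ n * indicator {\<rho>..1} t))"
      using borel_integrable_atLeastAtMost' [of \<rho> 1 "\<lambda>t::real. t ^ n"]
      by (simp add: set_integrable_def mult.commute continuous_on_power)
    show "integrable lborel (\<lambda>t. indicator {0..<1} t *\<^sub>R (t ^ n * logw t powr \<beta>))"
      by (rule logw_moment_upper [OF assms]) (simp add: set_integrable_def)
    show "AE t in lborel. A * (t ^ n * indicator {\<rho>..1} t) \<le> indicator {0..<1} t *\<^sub>R (t ^ n * logw t powr \<beta>)"
    \<comment> \<open>The comparison fails at t = 1, where the right-hand indicator vanishes and the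
      left side is positive.\<close>
    proof (rule AE_mp [OF AE_lborel_singleton [of 1]], rule AE_I2, rule impI)
      fix t :: real
      assume "t \<noteq> 1"
      show "A * (t ^ n * indicator {\<rho>..1} t) \<le> indicator {0..<1} t *\<^sub>R (t ^ n * logw t powr \<beta>)"
      proof (cases "t \<in> {\<rho>..1}")
        case True
        then have t: "\<rho> \<le> t" "0 \<le> t" "t < 1"
          using \<open>t \<noteq> 1\<close> \<rho> by auto
        have "A \<le> logw t powr \<beta>"
          unfolding A_def using t \<rho> assms logw_ge_1 [of \<rho>]
          by (intro powr_mono2 logw_mono) auto
        then show ?thesis
          using t mult_left_mono [OF \<open>A \<le> logw t powr \<beta>\<close>, of "t ^ n"] by (simp add: mult.commute)
      qed (auto simp: indicator_def)
    qed
  qed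
  finally show ?thesis
    by (simp add: set_lebesgue_integral_def A)
qed

section \<open>Growth and a test function in logarithmic Bloch spaces\<close>

lemma bloch_quotient_le_norm:
  assumes "f \<in> log_bloch \<alpha>" "z \<in> ball 0 1"
  shows "bloch_quotient \<alpha> f z \<le> (SUP z\<in>ball 0 1. bloch_quotient \<alpha> f z)"
    and "0 \<le> (SUP z\<in>ball 0 1. bloch_quotient \<alpha> f z)"
proof -
  have bdd: "bdd_above (bloch_quotient \<alpha> f ` ball 0 1)"
    using assms by (simp add: log_bloch_def)
  show "bloch_quotient \<alpha> f z \<le> (SUP z\<in>ball 0 1. bloch_quotient \<alpha> f z)"
    using cSUP_upper [OF assms(2) bdd] .
  then show "0 \<le> (SUP z\<in>ball 0 1. bloch_quotient \<alpha> f z)"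
    using bloch_quotient_nonneg [OF assms(2), of \<alpha> f] by simp
qed

text \<open>On the radius the Bloch condition bounds |f'(s)| by a multiple of logw(s)^\<alpha> / (1
  - s). Because \<alpha> + 1 > 0, this has the increasing antiderivative logw(s)^(\<alpha> + 1) /
  (\<alpha> + 1), which then bounds |f(t) - f(0)|.\<close>

lemma log_bloch_growth:
  assumes "\<alpha> > -1"
  obtains K where "K > 0"
    "\<And>f t. f \<in> log_bloch \<alpha> \<Longrightarrow> 0 \<le> t \<Longrightarrow> t < 1 \<Longrightarrow>
      norm (f (complex_of_real t)) \<le> K * log_bloch_norm \<alpha> f * logw t powr (\<alpha> + 1)"
proof -
  \<comment> \<open>The numerator pays for replacing s^2 by s in the weight, the denominator comes
    from the antiderivative.\<close>
  define c where "c = 2 powr \<bar>\<alpha>\<bar> / (\<alpha> + 1)"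
  have c: "c > 0"
    using assms by (simp add: c_def)
  have "norm (f (complex_of_real t)) \<le> (1 + c) * log_bloch_norm \<alpha> f * logw t powr (\<alpha> + 1)"
    if f: "f \<in> log_bloch \<alpha>" and t: "0 \<le> t" "t < 1" for f t
  proof -
    define M where "M = (SUP z\<in>ball 0 1. bloch_quotient \<alpha> f z)"
    have M0: "M \<ge> 0"
      using bloch_quotient_le_norm(2) [OF f, of 0] by (simp add: M_def)
    have hol: "f holomorphic_on ball 0 1"
      using f by (simp add: log_bloch_def)
    have fd: "(f has_field_derivative deriv f (of_real s)) (at (of_real s))" if "\<bar>s\<bar> < 1" for s
      using hol that by (intro holomorphic_derivI [OF hol]) auto
    define \<phi> where "\<phi> = (\<lambda>s. M * c * logw s powr (\<alpha> + 1))"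
    have \<phi>d: "(\<phi> has_real_derivative M * (2 powr \<bar>\<alpha>\<bar> * logw s powr \<alpha>) / (1 - s)) (at s)"
      if "0 \<le> s" "s < 1" for s
    proof -
      have "logw s > 0"
        using logw_ge_1 [of s] that by simp
      moreover have "(logw has_real_derivative 1 / (1 - s)) (at s)"
        unfolding logw_def using that by (auto intro!: derivative_eq_intros)
      ultimately have "(\<phi> has_real_derivative M * c * ((\<alpha> + 1) * logw s powr (\<alpha> + 1 - of_nat 1) * (1 / (1 - s)))) (at s)"
        unfolding \<phi>_def by (intro DERIV_cmult DERIV_fun_powr)
      then show ?thesis
        using assms by (simp add: c_def mult_ac)
    qed
    have deriv_le: "norm (deriv f (of_real s)) \<le> M * (2 powr \<bar>\<alpha>\<bar> * logw s powr \<alpha>) / (1 - s)"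
      if s: "0 < s" "s < 1" for s
    proof -
      have s2: "s\<^sup>2 < 1" "logw (s\<^sup>2) > 0"
        using s logw_ge_1 [of "s\<^sup>2"] by (auto simp: power_less_one_iff)
      have "(1 - s\<^sup>2) * logw (s\<^sup>2) powr (- \<alpha>) * norm (deriv f (of_real s)) \<le> M"
        using bloch_quotient_le_norm(1) [OF f, of "of_real s"] s
        by (simp add: M_def bloch_quotient_eq_logw)
      then have "norm (deriv f (of_real s)) \<le> M * logw (s\<^sup>2) powr \<alpha> / (1 - s\<^sup>2)"
        using s2 by (simp add: powr_minus field_simps)
      also have "\<dots> \<le> M * (2 powr \<bar>\<alpha>\<bar> * logw s powr \<alpha>) / (1 - s)"
        using s s2 M0 logw_square_powr_le [of s \<alpha>]
        by (intro frac_le mult_left_mono mult_nonneg_nonneg) (auto simp: power2_eq_square mult_left_le)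
      finally show ?thesis .
    qed
    have "norm (f (of_real t) - f 0) \<le> \<phi> t"
    proof (cases "t = 0")
      case True
      then show ?thesis
        using M0 c by (simp add: \<phi>_def)
    next
      case False
      have "norm ((\<lambda>s. f (complex_of_real s)) t - (\<lambda>s. f (complex_of_real s)) 0) \<le> \<phi> t - \<phi> 0"
      proof (rule differentiable_bound_general)
        show "0 < t"
          using False t by simp
        show "continuous_on {0..t} (\<lambda>s. f (complex_of_real s))"
          using t by (intro continuous_on_compose2 [OF holomorphic_on_imp_continuous_on [OF hol]] continuous_intros) auto
        show "continuous_on {0..t} \<phi>"
          using t by (intro DERIV_continuous_on [OF DERIV_subset [OF \<phi>d]]) auto
        fix s
        assume s: "0 < s" "s < t"
        show "((\<lambda>s. f (complex_of_real s)) has_vector_derivative deriv f (of_real s)) (at s)"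
          using s t by (intro has_vector_derivative_real_field fd) auto
        show "(\<phi> has_vector_derivative M * (2 powr \<bar>\<alpha>\<bar> * logw s powr \<alpha>) / (1 - s)) (at s)"
          using s t \<phi>d [of s] by (simp add: has_real_derivative_iff_has_vector_derivative)
        show "norm (deriv f (of_real s)) \<le> M * (2 powr \<bar>\<alpha>\<bar> * logw s powr \<alpha>) / (1 - s)"
          using deriv_le s t by simp
      qed
      moreover have "\<phi> 0 \<ge> 0"
        using M0 c by (simp add: \<phi>_def)
      ultimately show ?thesis
        by simp
    qed
    then have "norm (f (of_real t)) \<le> norm (f 0) + M * c * logw t powr (\<alpha> + 1)"
      using norm_triangle_ineq2 [of "f (of_real t)" "f 0"] by (simp add: \<phi>_def)
    also have "norm (f 0) \<le> norm (f 0) * logw t powr (\<alpha> + 1)"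
      using logw_ge_1 [OF t] assms by (simp add: mult_le_cancel_left1 ge_one_powr_ge_zero)
    then have "norm (f 0) + M * c * logw t powr (\<alpha> + 1) \<le> (norm (f 0) + M * c) * logw t powr (\<alpha> + 1)"
      by (simp add: algebra_simps)
    also have "\<dots> \<le> ((1 + c) * (norm (f 0) + M)) * logw t powr (\<alpha> + 1)"
      using M0 c by (intro mult_right_mono) (auto simp: algebra_simps)
    finally show ?thesis
      by (simp add: log_bloch_norm_def M_def)
  qed
  then show ?thesis
    using c by (intro that [of "1 + c"]) auto
qed

section \<open>A test function of maximal radial growth\<close>

definition log_test :: "real \<Rightarrow> complex \<Rightarrow> complex" where
  "log_test \<beta> z = (1 - Ln (1 - z)) powr of_real \<beta>"

lemma log_test_of_real:
  assumes "0 \<le> t" "t < 1"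
  shows "log_test \<beta> (of_real t) = of_real (logw t powr \<beta>)"
proof -
  have "1 - Ln (1 - complex_of_real t) = of_real (logw t)"
    using assms Ln_of_real [of "1 - t"] by (simp add: logw_def)
  then show ?thesis
    using logw_ge_1 [OF assms] by (simp add: log_test_def powr_of_real)
qed

text \<open>With w = 1 - Ln (1 - z) the derivative is (\<alpha> + 1) w^\<alpha> / (1 - z). As Im w
  is bounded, |w| is comparable to y = Re w = 1 - ln |1 - z|. Replacing y by \<open>logw r\<close>,
  r = |z|, costs at most a factor 4 u with u = |1 - z| / (1 - r), and the factor 1 / |1 - z| of the
  derivative pays for u.\<close>

lemma log_test_in_log_bloch:
  assumes "\<alpha> > -1"
  shows "log_test (\<alpha> + 1) \<in> log_bloch \<alpha>"
proof -
  define w where "w = (\<lambda>z. 1 - Ln (1 - z))"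
  \<comment> \<open>The 8 is 2 from 1 - r^2 \<le> 2 (1 - r) times 4 from \<open>4 * u\<close>; the
    powers of 2 and 17 come from \<open>logw (r\<^sup>2)\<close> against \<open>logw r\<close> and
    from |w| against y.\<close>
  define D where "D = \<bar>\<alpha> + 1\<bar> * (8 * 2 powr \<bar>\<alpha>\<bar> * 17 powr \<bar>\<alpha>\<bar>)"
  \<comment> \<open>Since |1 - z| \<le> 2 and ln 2 \<le> 3 / 4, w stays in the half-plane Re w \<ge>
    1 / 4, so both principal branches are holomorphic on the disc.\<close>
  have facts: "1 - z \<notin> \<real>\<^sub>\<le>\<^sub>0" "w z \<notin> \<real>\<^sub>\<le>\<^sub>0" "Re (w z) = 1 - ln (norm (1 - z))" "1 / 4 \<le> 1 - ln (norm (1 - z))"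
    if z: "z \<in> ball 0 1" for z
  proof -
    have "\<bar>Re z\<bar> < 1"
      using abs_Re_le_cmod [of z] z by simp
    then show 1: "1 - z \<notin> \<real>\<^sub>\<le>\<^sub>0"
      by (auto simp: complex_nonpos_Reals_iff)
    have nz: "1 - z \<noteq> 0"
      using 1 by auto
    have "norm (1 - z) \<le> 2"
      using norm_triangle_ineq4 [of 1 z] z by simp
    then have "ln (norm (1 - z)) \<le> ln 2"
      using nz by simp
    also have "ln (2::real) \<le> 3 / 4"
      using ln2_le_25_over_36 by simp
    finally show 2: "1 / 4 \<le> 1 - ln (norm (1 - z))"
      by simp
    show 3: "Re (w z) = 1 - ln (norm (1 - z))"
      using nz by (simp add: w_def)
    show "w z \<notin> \<real>\<^sub>\<le>\<^sub>0"
      using 2 3 by (auto simp: complex_nonpos_Reals_iff)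
  qed
  have deriv: "(log_test (\<alpha> + 1) has_field_derivative
      of_real (\<alpha> + 1) * w z powr of_real \<alpha> / (1 - z)) (at z)" if z: "z \<in> ball 0 1" for z
  proof -
    have "1 - z \<noteq> 0"
      using facts(1) [OF z] by auto
    then have "(w has_field_derivative 1 / (1 - z)) (at z)"
      unfolding w_def using facts(1) [OF z] by (auto intro!: derivative_eq_intros simp: divide_inverse)
    moreover have "((\<lambda>x. x powr of_real (\<alpha> + 1)) has_field_derivative
        of_real (\<alpha> + 1) * w z powr (of_real (\<alpha> + 1) - 1)) (at (w z))"
      using facts(2) [OF z] by (rule has_field_derivative_powr)
    ultimately have "((\<lambda>z. w z powr of_real (\<alpha> + 1)) has_field_derivative
        of_real (\<alpha> + 1) * w z powr (of_real (\<alpha> + 1) - 1) * (1 / (1 - z))) (at z)"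
      by (rule DERIV_chain2 [rotated])
    then show ?thesis
      by (simp add: w_def log_test_def [abs_def])
  qed
  have "log_test (\<alpha> + 1) holomorphic_on ball 0 1"
    unfolding holomorphic_on_open [OF open_ball] using deriv by blast
  moreover have "bloch_quotient \<alpha> (log_test (\<alpha> + 1)) z \<le> D" if z: "z \<in> ball 0 1" for z
  proof -
    define r where "r = norm z"
    define x where "x = norm (1 - z)"
    define y where "y = 1 - ln x"
    define u where "u = x / (1 - r)"
    have r: "0 \<le> r" "r < 1"
      using z by (auto simp: r_def)
    have x: "1 - r \<le> x"
      using norm_triangle_ineq2 [of 1 z] by (simp add: x_def r_def)
    have u: "u \<ge> 1"
      using r x by (simp add: u_def)
    have y: "y \<ge> 1 / 4" "Re (w z) = y"
      using facts [OF z] by (auto simp: y_def x_def)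
    have L1: "logw r \<ge> 1"
      using r by (rule logw_ge_1)
    \<comment> \<open>\<open>norm (w z) \<le> y + \<pi>\<close>, \<open>\<pi> < 4\<close> and \<open>1 / 4 \<le> y\<close> give the factor \<open>17\<close>.\<close>
    have "norm (w z) \<ge> y"
      using abs_Re_le_cmod [of "w z"] y by simp
    moreover have "norm (w z) \<le> 17 * y"
    proof -
      have "\<bar>Im (w z)\<bar> \<le> pi"
        using mpi_less_Im_Ln [of "1 - z"] Im_Ln_le_pi [of "1 - z"] facts(1) [OF z]
        by (cases "1 - z = 0") (auto simp: w_def)
      then have "norm (w z) \<le> y + 4"
        using cmod_le [of "w z"] y pi_less_4 by simp
      then show ?thesis
        using y by simp
    qed
    ultimately have wy: "norm (w z) powr \<alpha> \<le> 17 powr \<bar>\<alpha>\<bar> * y powr \<alpha>"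
      using y by (intro powr_le_comparable) auto
    have yL: "y powr \<alpha> \<le> 4 * u * logw r powr \<alpha>"
    proof (cases "\<alpha> \<ge> 0")
      case True
      have "y \<le> logw r"
        using x r by (simp add: y_def logw_def)
      then have "y powr \<alpha> \<le> 1 * logw r powr \<alpha>"
        using y True by (simp add: powr_mono2)
      also have "\<dots> \<le> 4 * u * logw r powr \<alpha>"
        using u by (intro mult_right_mono) auto
      finally show ?thesis .
    next
      case False
      have "logw r = y + ln u"
        using x r by (simp add: logw_def y_def u_def ln_div)
      also have "\<dots> \<le> y + 4 * y * (u - 1)"
        using ln_le_minus_one [of u] mult_right_mono [of 1 "4 * y" "u - 1"] u y by simp
      also have "\<dots> \<le> y * (4 * u)"
        using y by (simp add: algebra_simps)
      finally have "logw r / (4 * u) \<le> y"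
        using u by (simp add: field_simps)
      then have "y powr \<alpha> \<le> (logw r / (4 * u)) powr \<alpha>"
        using False L1 u by (intro powr_mono2') auto
      also have "\<dots> = logw r powr \<alpha> * (4 * u) powr (- \<alpha>)"
        using L1 u by (simp add: powr_divide powr_minus field_simps)
      \<comment> \<open>Here \<alpha> > -1 enters: the exponent -\<alpha> is below 1 and
        \<open>4 * u\<close> \<ge> 1, so only one factor u is lost.\<close>
      also have "\<dots> \<le> logw r powr \<alpha> * (4 * u) powr 1"
        using assms u by (intro mult_left_mono powr_mono) auto
      finally show ?thesis
        using u by (simp add: mult_ac)
    qed
    have "norm (deriv (log_test (\<alpha> + 1)) z) = \<bar>\<alpha> + 1\<bar> * norm (w z) powr \<alpha> / x"
      using DERIV_imp_deriv [OF deriv [OF z]]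
      by (simp add: norm_mult norm_divide norm_powr_real_powr' x_def del: of_real_add)
    then have "bloch_quotient \<alpha> (log_test (\<alpha> + 1)) z =
        (1 - r\<^sup>2) * logw (r\<^sup>2) powr (- \<alpha>) * (\<bar>\<alpha> + 1\<bar> * norm (w z) powr \<alpha> / x)"
      using z by (simp add: bloch_quotient_eq_logw r_def)
    also have "\<dots> \<le> (2 * (1 - r)) * (2 powr \<bar>\<alpha>\<bar> * logw r powr (- \<alpha>)) *
        (\<bar>\<alpha> + 1\<bar> * (17 powr \<bar>\<alpha>\<bar> * (4 * u * logw r powr \<alpha>)) / x)"
    proof (intro mult_mono divide_right_mono mult_left_mono)
      have "1 - r\<^sup>2 = (1 + r) * (1 - r)"
        by (simp add: power2_eq_square algebra_simps)
      then show "1 - r\<^sup>2 \<le> 2 * (1 - r)"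
        using r mult_right_mono [of "1 + r" 2 "1 - r"] by simp
      show "logw (r\<^sup>2) powr (- \<alpha>) \<le> 2 powr \<bar>\<alpha>\<bar> * logw r powr (- \<alpha>)"
        using logw_square_powr_le [OF r, of "- \<alpha>"] by simp
      show "norm (w z) powr \<alpha> \<le> 17 powr \<bar>\<alpha>\<bar> * (4 * u * logw r powr \<alpha>)"
        using wy yL by (smt (verit, best) mult_left_mono powr_ge_zero)
    qed (use r x in auto)
    also have "\<dots> = D * (logw r powr (- \<alpha>) * logw r powr \<alpha>) * ((1 - r) * u / x)"
      by (simp add: D_def)
    also have "\<dots> = D"
      using r x L1 by (simp add: u_def powr_minus field_simps)
    finally show ?thesis .
  qed
  ultimately show ?thesis
    by (auto simp: log_bloch_def intro!: bdd_aboveI2)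
qed

section \<open>Power series with nonnegative coefficients\<close>

text \<open>For the forward direction, the indices are split at \<open>sqrt N\<close>: above it the weights are comparable to
  \<open>ln N powr \<beta>\<close>, and below it even the weighted sum is \<open>O(sqrt N ln N powr \<beta>) = O(N)\<close>.\<close>

lemma weighted_sums_bigo_iff:
  fixes a :: "nat \<Rightarrow> real" and \<beta> :: real
  assumes a: "\<And>n. a n \<ge> 0" and \<beta>: "\<beta> > 0"
    and sqrt_bound: "\<And>x. x \<ge> 1 \<Longrightarrow> (1 + ln x) powr \<beta> \<le> K * sqrt x"
  shows "(\<lambda>N. \<Sum>n=1..N. a n * ln (real (n + 1)) powr \<beta>) \<in> O[sequentially](\<lambda>N. real N * ln (real N) powr \<beta>)
    \<longleftrightarrow> (\<lambda>N. \<Sum>n=1..N. a n) \<in> O[sequentially](\<lambda>N. real N)"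
proof
  define T where "T = (\<lambda>N. \<Sum>n=1..N. a n * ln (real (n + 1)) powr \<beta>)"
  assume "(\<lambda>N. \<Sum>n=1..N. a n * ln (real (n + 1)) powr \<beta>) \<in> O[sequentially](\<lambda>N. real N * ln (real N) powr \<beta>)"
  then obtain C where C: "C > 0"
    "\<forall>\<^sub>F N in sequentially. norm (T N) \<le> C * norm (real N * ln (real N) powr \<beta>)"
    unfolding T_def by (elim landau_o.bigE)
  then obtain N0 where N0: "\<And>N. N \<ge> N0 \<Longrightarrow> \<bar>T N\<bar> \<le> C * \<bar>real N * ln (real N) powr \<beta>\<bar>"
    by (auto simp: eventually_at_top_linorder)
  show "(\<lambda>N. \<Sum>n=1..N. a n) \<in> O[sequentially](\<lambda>N. real N)"
  proof (rule bigoI)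
    show "\<forall>\<^sub>F N in sequentially. norm (\<Sum>n=1..N. a n) \<le> (2 powr \<beta> * C + C * K / ln 2 powr \<beta>) * norm (real N)"
      \<comment> \<open>The square makes \<open>m\<close>, the integer part of sqrt N, at least
        \<open>N0\<close>, so the hypothesis applies at \<open>m\<close> as well as at
        \<open>N\<close>; the 4 keeps ln N positive.\<close>
      using eventually_ge_at_top [of "N0\<^sup>2 + 4"]
    proof eventually_elim
      case (elim N)
      define m where "m = nat \<lfloor>sqrt (real N)\<rfloor>"
      have N: "N \<ge> N0" "N \<ge> 2" "N0\<^sup>2 \<le> N"
        using elim le_square [of N0] unfolding power2_eq_square by linarith+
      have m_le: "real m \<le> sqrt (real N)"
        by (simp add: m_def)
      have le_m: "n \<le> m" if "n\<^sup>2 \<le> N" for n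
      proof -
        have "real n \<le> sqrt (real N)"
          using that by (intro real_le_rsqrt) (metis of_nat_le_iff of_nat_power)
        then show ?thesis
          by (simp add: m_def le_nat_floor)
      qed
      have m: "m \<ge> N0" "m \<ge> 1"
        using le_m [of N0] le_m [of 1] N by auto
      \<comment> \<open>For n > m, N \<le> (n + 1)^2 gives ln N \<le> 2 ln (n + 1), and the first
        term suffices. For n \<le> m the weight is at least its value ln 2 at n = 1, and these terms
        are charged to \<open>T m\<close>.\<close>
      have split: "a n \<le> 2 powr \<beta> / ln (real N) powr \<beta> * (a n * ln (real (n + 1)) powr \<beta>) +
          (if n \<le> m then a n * ln (real (n + 1)) powr \<beta> / ln 2 powr \<beta> else 0)" if n: "n \<ge> 1" for n
      proof (cases "n \<le> m")
        case True
        have "ln 2 powr \<beta> \<le> ln (real (n + 1)) powr \<beta>"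
          using n \<beta> by (intro powr_mono2) auto
        then have "a n \<le> a n * ln (real (n + 1)) powr \<beta> / ln 2 powr \<beta>"
          using a [of n] by (simp add: field_simps mult_left_mono)
        then show ?thesis
          using True a [of n] by (simp add: add_increasing)
      next
        case False
        then have "\<not> n\<^sup>2 \<le> N"
          using le_m by blast
        then have "N \<le> (n + 1)\<^sup>2"
          by (simp add: power2_eq_square)
        then have "real N \<le> real (n + 1) ^ 2"
          by (metis of_nat_le_iff of_nat_power)
        then have "ln (real N) \<le> ln (real (n + 1) ^ 2)"
          using N by (subst ln_le_cancel_iff) auto
        then have "ln (real N) \<le> 2 * ln (real (n + 1))"
          by (simp add: ln_realpow)
        then have "ln (real N) powr \<beta> \<le> (2 * ln (real (n + 1))) powr \<beta>"
          using N \<beta> by (intro powr_mono2) auto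
        then have "1 \<le> 2 powr \<beta> / ln (real N) powr \<beta> * ln (real (n + 1)) powr \<beta>"
          using N by (simp add: powr_mult field_simps)
        then have "a n * 1 \<le> a n * (2 powr \<beta> / ln (real N) powr \<beta> * ln (real (n + 1)) powr \<beta>)"
          using a [of n] by (intro mult_left_mono)
        then show ?thesis
          using False by (simp add: mult_ac)
      qed
      have "(\<Sum>n=1..N. a n) \<le> (\<Sum>n=1..N. 2 powr \<beta> / ln (real N) powr \<beta> * (a n * ln (real (n + 1)) powr \<beta>) +
          (if n \<le> m then a n * ln (real (n + 1)) powr \<beta> / ln 2 powr \<beta> else 0))"
        by (intro sum_mono split) auto
      also have "\<dots> = 2 powr \<beta> / ln (real N) powr \<beta> * T N +
          (\<Sum>n\<in>{1..N} \<inter> {n. n \<le> m}. a n * ln (real (n + 1)) powr \<beta> / ln 2 powr \<beta>)"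
        by (simp add: sum.distrib T_def sum_distrib_left sum.If_cases)
      also have "\<dots> \<le> 2 powr \<beta> / ln (real N) powr \<beta> * T N + T m / ln 2 powr \<beta>"
        unfolding T_def sum_divide_distrib using a
        by (intro add_left_mono sum_mono2) auto
      also have "2 powr \<beta> / ln (real N) powr \<beta> * T N
          \<le> 2 powr \<beta> / ln (real N) powr \<beta> * (C * (real N * ln (real N) powr \<beta>))"
        using N0 [OF N(1)] by (intro mult_left_mono) auto
      also have "\<dots> = 2 powr \<beta> * C * real N"
        using N by simp
      also have "T m \<le> C * K * real N"
      proof -
        have "T m \<le> C * (real m * ln (real m) powr \<beta>)"
          using N0 [OF m(1)] by simp
        also have "\<dots> \<le> C * (sqrt (real N) * (K * sqrt (real N)))"
        proof (intro mult_left_mono mult_mono)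
          have "real m ^ 2 \<le> real N"
            using power_mono [OF m_le, of 2] by simp
          then have "m \<le> N"
            by (metis of_nat_le_iff of_nat_power power2_nat_le_imp_le)
          then have "ln (real m) \<le> 1 + ln (real N)"
            using m by (smt (verit) ln_mono of_nat_le_iff of_nat_1)
          then have "ln (real m) powr \<beta> \<le> (1 + ln (real N)) powr \<beta>"
            using m \<beta> by (intro powr_mono2) auto
          also have "\<dots> \<le> K * sqrt (real N)"
            using N by (intro sqrt_bound) auto
          finally show "ln (real m) powr \<beta> \<le> K * sqrt (real N)" .
        qed (use m_le C in auto)
        also have "\<dots> = C * K * (sqrt (real N) * sqrt (real N))"
          by (simp only: mult_ac)
        finally show ?thesis
          by simp
      qed
      then have "T m / ln 2 powr \<beta> \<le> C * K * real N / ln 2 powr \<beta>"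
        by (intro divide_right_mono) auto
      finally have "(\<Sum>n=1..N. a n) \<le> (2 powr \<beta> * C + C * K / ln 2 powr \<beta>) * real N"
        by (simp add: algebra_simps)
      then show ?case
        using a by (simp add: sum_nonneg)
    qed
  qed
next
  assume "(\<lambda>N. \<Sum>n=1..N. a n) \<in> O[sequentially](\<lambda>N. real N)"
  then obtain C where C: "C > 0"
    "\<forall>\<^sub>F N in sequentially. norm (\<Sum>n=1..N. a n) \<le> C * norm (real N)"
    by (elim landau_o.bigE)
  show "(\<lambda>N. \<Sum>n=1..N. a n * ln (real (n + 1)) powr \<beta>) \<in> O[sequentially](\<lambda>N. real N * ln (real N) powr \<beta>)"
  proof (rule bigoI)
    show "\<forall>\<^sub>F N in sequentially. norm (\<Sum>n=1..N. a n * ln (real (n + 1)) powr \<beta>)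
        \<le> (C * 2 powr \<beta>) * norm (real N * ln (real N) powr \<beta>)"
      using C(2) eventually_ge_at_top [of 2]
    proof eventually_elim
      case (elim N)
      \<comment> \<open>N + 1 \<le> N^2 makes every weight in the sum at most that of 2 ln
        N.\<close>
      have "2 * real N \<le> real N * real N" "real N \<ge> 2"
        using elim(2) by (auto intro!: mult_right_mono)
      then have "real (N + 1) \<le> real N ^ 2"
        unfolding power2_eq_square of_nat_add of_nat_1 by linarith
      then have "ln (real (N + 1)) \<le> ln (real N ^ 2)"
        using elim(2) by (subst ln_le_cancel_iff) auto
      then have lnN: "ln (real (N + 1)) \<le> 2 * ln (real N)"
        using elim(2) by (simp add: ln_realpow)
      have "(\<Sum>n=1..N. a n * ln (real (n + 1)) powr \<beta>) \<le> (\<Sum>n=1..N. a n * (2 * ln (real N)) powr \<beta>)"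
      proof (intro sum_mono mult_left_mono powr_mono2)
        fix n
        assume "n \<in> {1..N}"
        then have "ln (real (n + 1)) \<le> ln (real (N + 1))"
          by simp
        then show "ln (real (n + 1)) \<le> 2 * ln (real N)"
          using lnN by linarith
      qed (use a \<beta> in auto)
      also have "\<dots> = (\<Sum>n=1..N. a n) * (2 * ln (real N)) powr \<beta>"
        by (simp add: sum_distrib_right)
      also have "\<dots> \<le> C * real N * (2 * ln (real N)) powr \<beta>"
        using elim(1) by (intro mult_right_mono) auto
      finally show ?case
        using elim(2) a by (simp add: powr_mult mult_ac sum_nonneg abs_of_nonneg)
    qed
  qed
qed

text \<open>At the radius r = 1 - 1 / (2 (k + 1)) Bernoulli's inequality gives r^k \<ge> 1 / 2, so
  every term up to k keeps at least half of its coefficient.\<close>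

lemma partial_sum_le_power_series:
  fixes c :: "nat \<Rightarrow> real"
  assumes c: "\<And>n. c n \<ge> 0"
    and sums: "(\<lambda>n. c n * (1 - 1 / (2 * real (k + 1))) ^ n) sums H"
  shows "(\<Sum>n\<le>k. c n) \<le> 2 * H"
proof -
  define r where "r = 1 - 1 / (2 * real (k + 1))"
  have r: "0 \<le> r" "r \<le> 1"
    by (auto simp: r_def field_simps)
  have "1 + real k * (- (1 / (2 * real (k + 1)))) \<le> (1 + (- (1 / (2 * real (k + 1))))) ^ k"
    by (rule Bernoulli_inequality) (auto simp: field_simps)
  moreover have "1 / 2 \<le> 1 + real k * (- (1 / (2 * real (k + 1))))"
    by (simp add: field_simps)
  moreover have "r = 1 + (- (1 / (2 * real (k + 1))))"
    by (simp add: r_def)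
  ultimately have rk: "1 / 2 \<le> r ^ k"
    by (metis order.trans)
  have "(\<Sum>n\<le>k. c n * (1 / 2)) \<le> (\<Sum>n\<le>k. c n * r ^ n)"
  proof (intro sum_mono mult_left_mono c)
    fix n
    assume "n \<in> {..k}"
    then have "r ^ k \<le> r ^ n"
      using r by (intro power_decreasing) auto
    with rk show "1 / 2 \<le> r ^ n"
      by simp
  qed
  also have "\<dots> \<le> H"
    using sums c r sum_le_suminf [of "\<lambda>n. c n * r ^ n" "{..k}"]
    by (auto simp: r_def sums_iff)
  finally show ?thesis
    by (simp flip: sum_divide_distrib)
qed

text \<open>Multiplying by the geometric series replaces coefficients by partial sums: H / (1 - r)
  is the sum of S_k r^k, at most C times the sum of (k + 1) r^k, which is C / (1 - r)^2.\<close>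

lemma power_series_le_of_partial_sums:
  fixes d :: "nat \<Rightarrow> real"
  assumes d: "\<And>n. d n \<ge> 0" and C: "\<And>k. (\<Sum>n\<le>k. d n) \<le> C * real (k + 1)"
    and r: "0 \<le> r" "r < 1" and sums: "(\<lambda>n. d n * r ^ n) sums H"
  shows "(1 - r) * H \<le> C"
proof -
  have "(\<lambda>k. \<Sum>i\<le>k. (d i * r ^ i) * r ^ (k - i)) sums ((\<Sum>k. d k * r ^ k) * (\<Sum>k. r ^ k))"
    using sums d r by (intro Cauchy_product_sums) (auto simp: sums_iff abs_mult power_abs)
  moreover have "(\<Sum>i\<le>k. (d i * r ^ i) * r ^ (k - i)) = (\<Sum>i\<le>k. d i) * r ^ k" for k
    unfolding sum_distrib_right
    by (intro sum.cong) (auto simp: power_add [symmetric])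
  ultimately have "(\<lambda>k. (\<Sum>i\<le>k. d i) * r ^ k) sums (H / (1 - r))"
    using sums r by (simp add: sums_iff suminf_geometric)
  moreover have "(\<lambda>k. C * (of_nat (Suc k) * r ^ k)) sums (C * (1 / (1 - r)\<^sup>2))"
    using r by (intro sums_mult geometric_deriv_sums) auto
  ultimately have "H / (1 - r) \<le> C * (1 / (1 - r)\<^sup>2)"
  proof (rule sums_le [rotated])
    fix k
    show "(\<Sum>i\<le>k. d i) * r ^ k \<le> C * (of_nat (Suc k) * r ^ k)"
      using mult_right_mono [OF C [of k], of "r ^ k"] r by (simp add: mult.assoc)
  qed
  then have "H / (1 - r) * (1 - r)\<^sup>2 \<le> C * (1 / (1 - r)\<^sup>2) * (1 - r)\<^sup>2"
    by (rule mult_right_mono) simp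
  then show ?thesis
    using r by (simp add: power2_eq_square mult.commute)
qed

text \<open>Carries the complex series of a derivative over to a real series on the positive radius,
  where its sum is real and nonnegative and so equals its norm.\<close>

lemma power_series_nonneg_on_reals:
  fixes d :: "nat \<Rightarrow> real"
  assumes "\<And>n. d n \<ge> 0" "(\<lambda>n. complex_of_real (d n) * complex_of_real r ^ n) sums s" "r \<ge> 0"
  shows "(\<lambda>n. d n * r ^ n) sums norm s"
proof -
  have R: "(\<lambda>n. d n * r ^ n) sums Re s"
    using sums_Re [OF assms(2)] by (simp flip: of_real_power of_real_mult)
  have "Im s = 0"
    using sums_unique2 [OF sums_Im [OF assms(2)]] by (simp flip: of_real_power of_real_mult)
  moreover have "Re s \<ge> 0"
    using assms by (intro sums_le [OF _ sums_zero R]) auto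
  ultimately show ?thesis
    using R by (simp add: cmod_eq_Re)
qed

text \<open>To pass from an eventual bound to one for every k, the sum is lengthened by
  \<open>N0\<close> nonnegative terms, which moves it into the range of the eventual bound at the
  cost of a factor \<open>N0 + 1\<close>.\<close>

lemma sums_linear_bigo_iff:
  fixes a :: "nat \<Rightarrow> real"
  assumes a: "\<And>n. a n \<ge> 0"
  shows "(\<lambda>N. \<Sum>n=1..N. a n) \<in> O[sequentially](\<lambda>N. real N) \<longleftrightarrow>
    (\<exists>C. \<forall>k. (\<Sum>n\<le>k. a (Suc n)) \<le> C * real (k + 1))"
proof -
  have shift: "(\<Sum>n=1..Suc k. a n) = (\<Sum>n\<le>k. a (Suc n))" for k
    by (simp only: One_nat_def sum.atLeast_Suc_atMost_Suc_shift o_def atMost_atLeast0)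
  show ?thesis
  proof
    assume "(\<lambda>N. \<Sum>n=1..N. a n) \<in> O[sequentially](\<lambda>N. real N)"
    then obtain C where C: "C > 0"
      "\<forall>\<^sub>F N in sequentially. norm (\<Sum>n=1..N. a n) \<le> C * norm (real N)"
      by (elim landau_o.bigE)
    then obtain N0 where N0: "\<And>N. N \<ge> N0 \<Longrightarrow> (\<Sum>n=1..N. a n) \<le> C * real N"
      by (auto simp: eventually_at_top_linorder intro: order.trans [OF abs_ge_self])
    have "(\<Sum>n\<le>k. a (Suc n)) \<le> C * real (N0 + 1) * real (k + 1)" for k
    proof -
      have "(\<Sum>n\<le>k. a (Suc n)) = (\<Sum>n=1..Suc k. a n)"
        by (rule shift [symmetric])
      also have "\<dots> \<le> (\<Sum>n=1..N0 + Suc k. a n)"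
        using a by (intro sum_mono2) auto
      also have "\<dots> \<le> C * real (N0 + Suc k)"
        by (intro N0) auto
      also have "\<dots> \<le> C * (real (N0 + 1) * real (k + 1))"
        using C by (intro mult_left_mono) (auto simp: algebra_simps)
      finally show ?thesis
        by (simp add: mult.assoc)
    qed
    then show "\<exists>C. \<forall>k. (\<Sum>n\<le>k. a (Suc n)) \<le> C * real (k + 1)"
      by blast
  next
    assume "\<exists>C. \<forall>k. (\<Sum>n\<le>k. a (Suc n)) \<le> C * real (k + 1)"
    then obtain C where C: "\<And>k. (\<Sum>n\<le>k. a (Suc n)) \<le> C * real (k + 1)"
      by blast
    have "\<forall>\<^sub>F N in sequentially. norm (\<Sum>n=1..N. a n) \<le> C * norm (real N)"
      using eventually_ge_at_top [of 1]
    proof eventually_elim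
      case (elim N)
      then obtain k where "N = Suc k"
        by (cases N) auto
      then show ?case
        using C [of k] shift [of k] a by (simp add: sum_nonneg abs_of_nonneg)
    qed
    then show "(\<lambda>N. \<Sum>n=1..N. a n) \<in> O[sequentially](\<lambda>N. real N)"
      by (rule bigoI)
  qed
qed

section \<open>The generalized Hilbert operator as a coefficient multiplier\<close>

text \<open>The series of g'(t z) is integrated term by term; the n-th term is dominated by d_n
  |z|^n w(t), a summable sequence times an integrable function.\<close>

lemma hilbert_op_power_series:
  fixes d :: "nat \<Rightarrow> real" and f g :: "complex \<Rightarrow> complex"
  defines "m \<equiv> \<lambda>n. LINT t:{0..<1}|lborel. complex_of_real t ^ n * f (complex_of_real t)"
  assumes d: "\<And>n. d n \<ge> 0"
    and dser: "\<And>z. z \<in> ball 0 1 \<Longrightarrow> (\<lambda>n. complex_of_real (d n) * z ^ n) sums deriv g z"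
    and f: "continuous_on (ball 0 1) f"
    and int: "\<And>n. set_integrable lborel {0..<1} (\<lambda>t. t ^ n * w t)"
    and bound: "\<And>t. 0 \<le> t \<Longrightarrow> t < 1 \<Longrightarrow> norm (f (complex_of_real t)) \<le> w t"
  shows "z \<in> ball 0 1 \<Longrightarrow> (\<lambda>n. complex_of_real (d n) * m n * z ^ n) sums hilbert_op g f z"
    and "norm (m n) \<le> (LBINT t:{0..<1}. t ^ n * w t)"
proof -
  have meas: "set_borel_measurable lborel {0..<1} (\<lambda>t. complex_of_real t ^ n * f (complex_of_real t))" for n
  proof -
    have "(\<lambda>t. indicator {0..<1} t *\<^sub>R (complex_of_real t ^ n * f (complex_of_real t))) \<in> borel_measurable borel"
      by (intro borel_measurable_continuous_on_indicator continuous_intros continuous_on_compose2 [OF f]) auto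
    then show ?thesis
      by (simp add: set_borel_measurable_def)
  qed
  have le: "norm (complex_of_real t ^ n * f (complex_of_real t)) \<le> t ^ n * w t" if "t \<in> {0..<1}" for t n
    using that bound [of t] by (simp add: norm_mult norm_power mult_left_mono)
  have m_int: "set_integrable lborel {0..<1} (\<lambda>t. complex_of_real t ^ n * f (complex_of_real t))" for n
    using le by (intro set_integrable_bound [OF int [of n] meas] AE_I2) (metis abs_ge_self order.trans real_norm_def)
  show "norm (m n) \<le> (LBINT t:{0..<1}. t ^ n * w t)" for n
  proof -
    have "norm (m n) \<le> (LBINT t:{0..<1}. norm (complex_of_real t ^ n * f (complex_of_real t)))"
      unfolding m_def by (rule set_integral_norm_bound [OF m_int])
    also have "\<dots> \<le> (LBINT t:{0..<1}. t ^ n * w t)"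
      using le by (intro set_integral_mono set_integrable_norm m_int int)
    finally show ?thesis .
  qed
  show "(\<lambda>n. complex_of_real (d n) * m n * z ^ n) sums hilbert_op g f z" if z: "z \<in> ball 0 1"
  proof -
    define F where "F = (\<lambda>n t. complex_of_real (d n) * z ^ n *
      (indicator {0..<1} t *\<^sub>R (complex_of_real t ^ n * f (complex_of_real t))))"
    have F_int: "integrable lborel (F n)" for n
      using m_int [of n] unfolding F_def set_integrable_def by (rule integrable_mult_right)
    have F_val: "integral\<^sup>L lborel (F n) = complex_of_real (d n) * m n * z ^ n" for n
      unfolding F_def m_def set_lebesgue_integral_def integral_mult_right_zero by (simp only: mult_ac)
    have F_sums: "(\<lambda>n. F n t) sums (indicator {0..<1} t *\<^sub>R (f (complex_of_real t) * deriv g (complex_of_real t * z)))" for t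
    proof (cases "t \<in> {0..<1}")
      case True
      then have "norm (complex_of_real t * z) < 1"
        using z mult_strict_mono [of t 1 "norm z" 1] mult_left_le_one_le [of "norm z" t] by (simp add: norm_mult)
      then have "(\<lambda>n. f (complex_of_real t) * (complex_of_real (d n) * (complex_of_real t * z) ^ n)) sums
          (f (complex_of_real t) * deriv g (complex_of_real t * z))"
        by (intro sums_mult dser) simp
      then show ?thesis
        using True by (simp add: F_def power_mult_distrib mult_ac)
    qed (simp add: F_def)
    \<comment> \<open>Nonnegative coefficients make convergence at the real point |z| the same as
      absolute convergence at z.\<close>
    have abs_sum: "summable (\<lambda>n. d n * norm z ^ n)"
      using power_series_nonneg_on_reals [OF d dser [of "of_real (norm z)"]] z
      by (simp add: sums_iff)
    have w0: "0 \<le> w t" if "t \<in> {0..<1}" for t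
      using order.trans [OF norm_ge_zero bound [of t]] that by simp
    have F_norm: "norm (F n t) \<le> d n * norm z ^ n * (indicator {0..<1} t *\<^sub>R w t)" for n t
    proof (cases "t \<in> {0..<1}")
      case True
      have "norm (complex_of_real t ^ n * f (complex_of_real t)) \<le> 1 * w t"
        using True w0 [of t] by (intro order.trans [OF le [OF True]] mult_right_mono power_le_one) auto
      then show ?thesis
        using True d [of n] by (simp add: F_def norm_mult norm_power mult_left_mono)
    qed (simp add: F_def)
    have w_int: "integrable lborel (\<lambda>t. indicator {0..<1} t *\<^sub>R w t)"
      using int [of 0] by (simp add: set_integrable_def)
    have "(\<lambda>n. integral\<^sup>L lborel (F n)) sums integral\<^sup>L lborel (\<lambda>t. \<Sum>n. F n t)"
    proof (rule sums_integral [OF F_int])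
      show "AE t in lborel. summable (\<lambda>n. norm (F n t))"
        using F_norm by (intro AE_I2 summable_comparison_test' [OF summable_mult2 [OF abs_sum]]) auto
      show "summable (\<lambda>n. LINT t|lborel. norm (F n t))"
      proof (rule summable_comparison_test' [OF summable_mult2 [OF abs_sum]])
        fix n
        have "(LINT t|lborel. norm (F n t)) \<le> (LINT t|lborel. d n * norm z ^ n * (indicator {0..<1} t *\<^sub>R w t))"
          by (intro integral_mono integrable_norm F_int integrable_mult_right w_int F_norm)
        also have "\<dots> = d n * norm z ^ n * (LINT t|lborel. indicator {0..<1} t *\<^sub>R w t)"
          by (rule integral_mult_right_zero)
        finally show "norm (LINT t|lborel. norm (F n t)) \<le> d n * norm z ^ n * (LINT t|lborel. indicator {0..<1} t *\<^sub>R w t)"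
          by simp
      qed
    qed
    also have "(\<lambda>t. \<Sum>n. F n t) =
        (\<lambda>t. indicator {0..<1} t *\<^sub>R (f (complex_of_real t) * deriv g (complex_of_real t * z)))"
      using F_sums by (auto simp: sums_iff fun_eq_iff)
    finally show ?thesis
      by (simp add: F_val hilbert_op_def set_lebesgue_integral_def)
  qed
qed

lemma holomorphic_of_power_series:
  assumes "\<And>z. z \<in> ball 0 1 \<Longrightarrow> (\<lambda>n. c n * z ^ n) sums h z"
  shows "h holomorphic_on ball 0 1"
    and "z \<in> ball 0 1 \<Longrightarrow> (\<lambda>n. of_nat (Suc n) * c (Suc n) * z ^ n) sums deriv h z"
proof -
  show hol: "h holomorphic_on ball 0 1"
    using assms by (intro power_series_holomorphic [of 0 1 c]) simp
  show "(\<lambda>n. of_nat (Suc n) * c (Suc n) * z ^ n) sums deriv h z" if "z \<in> ball 0 1"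
  proof -
    have "(\<lambda>n. diffs c n * z ^ n) sums deriv h z"
      using assms that by (intro termdiffs_sums_strong [of 1 _ h] holomorphic_derivI [OF hol]) auto
    then show ?thesis
      by (simp add: diffs_def)
  qed
qed

text \<open>The loss from replacing \<open>ln n\<close> by \<open>logw r\<close> is absorbed by moving \<open>r\<close> halfway to \<open>1\<close>.\<close>

lemma log_weight_times_power_le:
  assumes C: "C \<ge> 1" "\<And>x. x \<ge> 1 \<Longrightarrow> (1 + ln x) powr \<beta> \<le> C * sqrt x"
    and "\<beta> > 0" and r: "0 \<le> r" "r < 1"
  shows "(1 + ln (real (n + 2))) powr \<beta> * r ^ n \<le> 4 * C * logw r powr \<beta> * ((1 + r) / 2) ^ n"
proof -
  define x where "x = 1 - r"
  \<comment> \<open>\<open>y\<close> measures n on the scale 1 / (1 - r), which splits ln (n + 2)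
    into ln (1 / (1 - r)) + ln y. Below, 1 + y replaces y to keep the logarithm nonnegative.\<close>
  define y where "y = real (n + 2) * x"
  have x: "0 < x" "x \<le> 1"
    using r by (auto simp: x_def)
  have y: "y > 0"
    using x by (simp add: y_def)
  have L: "logw r \<ge> 1"
    using r by (rule logw_ge_1)
  have "real (n + 2) = y / x"
    using x by (simp add: y_def)
  also have "\<dots> \<le> (1 + y) / x"
    using x by (simp add: divide_right_mono)
  finally have "ln (real (n + 2)) \<le> ln ((1 + y) / x)"
    using x y by (subst ln_le_cancel_iff) auto
  then have "1 + ln (real (n + 2)) \<le> logw r + ln (1 + y)"
    using x y by (simp add: ln_div logw_def x_def)
  also have "\<dots> \<le> logw r + logw r * ln (1 + y)"
    using mult_right_mono [OF L, of "ln (1 + y)"] y by simp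
  also have "\<dots> = logw r * (1 + ln (1 + y))"
    by (simp add: algebra_simps)
  finally have "(1 + ln (real (n + 2))) powr \<beta> \<le> (logw r * (1 + ln (1 + y))) powr \<beta>"
    using assms(3) by (intro powr_mono2) auto
  also have "\<dots> = logw r powr \<beta> * (1 + ln (1 + y)) powr \<beta>"
    using L y by (simp add: powr_mult)
  also have "\<dots> \<le> logw r powr \<beta> * (C * (4 * (1 + real n * (x / 2))))"
  proof (rule mult_left_mono)
    have "(1 + ln (1 + y)) powr \<beta> \<le> C * sqrt (1 + y)"
      using y by (intro C) auto
    also have "sqrt (1 + y) \<le> 1 + y"
      using y by (intro real_le_lsqrt) (auto simp: power2_eq_square algebra_simps)
    also have "1 + y \<le> 4 * (1 + real n * (x / 2))"
    proof -
      have "y = real n * x + 2 * x" "4 * (1 + real n * (x / 2)) = 4 + 2 * (real n * x)"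
        by (auto simp: y_def algebra_simps)
      moreover have "0 \<le> real n * x"
        using x by simp
      ultimately show ?thesis
        using x by linarith
    qed
    finally show "(1 + ln (1 + y)) powr \<beta> \<le> C * (4 * (1 + real n * (x / 2)))"
      using C(1) by (simp add: mult_left_mono)
  qed auto
  finally have "(1 + ln (real (n + 2))) powr \<beta> * r ^ n
      \<le> logw r powr \<beta> * (C * (4 * (1 + real n * (x / 2)))) * r ^ n"
    using r by (intro mult_right_mono) auto
  also have "\<dots> = 4 * C * logw r powr \<beta> * ((1 + real n * (x / 2)) * r ^ n)"
    by (simp add: mult_ac)
  \<comment> \<open>Bernoulli's inequality turns the linear factor into an n-th power, and (1 + x /
    2) r \<le> (1 + r) / 2.\<close>
  also have "\<dots> \<le> 4 * C * logw r powr \<beta> * ((1 + x / 2) ^ n * r ^ n)"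
    using C(1) r x Bernoulli_inequality [of "x / 2" n]
    by (intro mult_left_mono mult_right_mono) auto
  also have "\<dots> \<le> 4 * C * logw r powr \<beta> * ((1 + r) / 2) ^ n"
  proof -
    have "x * r \<le> x"
      using r x by (simp add: mult_left_le)
    moreover have "(1 + x / 2) * r = r + x * r / 2" "(1 + r) / 2 = r + x / 2"
      by (auto simp: x_def field_simps)
    ultimately have "(1 + x / 2) * r \<le> (1 + r) / 2"
      by linarith
    then have "((1 + x / 2) * r) ^ n \<le> ((1 + r) / 2) ^ n"
      using r x by (intro power_mono) auto
    then show ?thesis
      using C(1) by (intro mult_left_mono) (auto simp: power_mult_distrib)
  qed
  finally show ?thesis .
qed

text \<open>By nonnegativity |g'| on a circle is largest at the positive radius, so being Bloch
  means that the sum of d_n r^n is O(1 / (1 - r)). The radii 1 - 1 / (2 (k + 1)) give the partial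
  sums; the geometric series argument gives the converse.\<close>

lemma bloch_iff_partial_sums:
  fixes d :: "nat \<Rightarrow> real"
  assumes g: "g holomorphic_on ball 0 1" and d: "\<And>n. d n \<ge> 0"
    and dser: "\<And>z. z \<in> ball 0 1 \<Longrightarrow> (\<lambda>n. complex_of_real (d n) * z ^ n) sums deriv g z"
  shows "g \<in> bloch \<longleftrightarrow> (\<exists>C. \<forall>k. (\<Sum>n\<le>k. d n) \<le> C * real (k + 1))"
proof -
  have quot: "bloch_quotient 0 g z = (1 - (norm z)\<^sup>2) * norm (deriv g z)" if z: "z \<in> ball 0 1" for z
  proof -
    have "(norm z)\<^sup>2 < 1"
      using z by (simp add: power_less_one_iff)
    \<comment> \<open>The weight to the power 0 is 1 only for a nonzero base, because
      \<open>0 powr 0\<close> is 0.\<close>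
    then have "logw ((norm z)\<^sup>2) \<noteq> 0"
      using logw_ge_1 [of "(norm z)\<^sup>2"] by auto
    then show ?thesis
      using z by (simp add: bloch_quotient_eq_logw)
  qed
  have real_sums: "(\<lambda>n. d n * r ^ n) sums norm (deriv g (of_real r))" if "0 \<le> r" "r < 1" for r
    using that by (intro power_series_nonneg_on_reals d dser) auto
  show ?thesis
  proof
    assume "g \<in> bloch"
    then obtain B where B: "\<And>z. z \<in> ball 0 1 \<Longrightarrow> bloch_quotient 0 g z \<le> B"
      unfolding log_bloch_def bdd_above_def by blast
    have "(\<Sum>n\<le>k. d n) \<le> 4 * B * real (k + 1)" for k
    proof -
      define x where "x = 1 / (2 * real (k + 1))"
      define r where "r = 1 - x"
      have x: "0 < x" "x \<le> 1 / 2"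
        by (auto simp: x_def field_simps)
      then have r: "0 \<le> r" "r < 1"
        by (auto simp: r_def)
      have "x * norm (deriv g (of_real r)) \<le> (1 - r\<^sup>2) * norm (deriv g (of_real r))"
      proof (rule mult_right_mono)
        have "r\<^sup>2 \<le> r"
          using r by (simp add: power2_eq_square mult_left_le)
        then show "x \<le> 1 - r\<^sup>2"
          by (simp add: r_def)
      qed simp
      also have "\<dots> \<le> B"
        using B [of "of_real r"] quot [of "of_real r"] r by simp
      finally have "norm (deriv g (of_real r)) \<le> 2 * B * real (k + 1)"
        by (simp add: x_def field_simps)
      moreover have "(\<Sum>n\<le>k. d n) \<le> 2 * norm (deriv g (of_real r))"
        using real_sums [OF r] by (intro partial_sum_le_power_series d) (simp add: r_def x_def)
      ultimately show ?thesis
        by simp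
    qed
    then show "\<exists>C. \<forall>k. (\<Sum>n\<le>k. d n) \<le> C * real (k + 1)"
      by blast
  next
    assume "\<exists>C. \<forall>k. (\<Sum>n\<le>k. d n) \<le> C * real (k + 1)"
    then obtain C where C: "\<And>k. (\<Sum>n\<le>k. d n) \<le> C * real (k + 1)"
      by blast
    have "bloch_quotient 0 g z \<le> 2 * C" if z: "z \<in> ball 0 1" for z
    proof -
      define r where "r = norm z"
      have r: "0 \<le> r" "r < 1"
        using z by (auto simp: r_def)
      have "norm (deriv g z) \<le> norm (deriv g (of_real r))"
      proof -
        have "norm (\<Sum>n. complex_of_real (d n) * z ^ n) \<le> (\<Sum>n. d n * r ^ n)"
          using real_sums [OF r] d
          by (intro norm_suminf_le) (auto simp: r_def norm_mult norm_power sums_iff)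
        then show ?thesis
          using dser [OF z] real_sums [OF r] by (simp add: sums_iff)
      qed
      moreover have "1 - r\<^sup>2 = (1 + r) * (1 - r)"
        by (simp add: power2_eq_square algebra_simps)
      then have "0 \<le> 1 - r\<^sup>2" "1 - r\<^sup>2 \<le> 2 * (1 - r)"
        using r mult_right_mono [of "1 + r" 2 "1 - r"] by auto
      ultimately have "(1 - r\<^sup>2) * norm (deriv g z) \<le> 2 * (1 - r) * norm (deriv g (of_real r))"
        by (intro mult_mono) auto
      also have "\<dots> \<le> 2 * C"
        using power_series_le_of_partial_sums [OF d C r real_sums [OF r]] by (simp add: algebra_simps)
      finally show ?thesis
        using quot [OF z] by (simp add: r_def)
    qed
    then show "g \<in> bloch"
      using g by (auto simp: log_bloch_def intro!: bdd_aboveI2)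
  qed
qed

section \<open>Boundedness of the operator on logarithmic Bloch spaces\<close>

lemma log_bloch_norm_nonneg: "f \<in> log_bloch \<alpha> \<Longrightarrow> 0 \<le> log_bloch_norm \<alpha> f"
  using bloch_quotient_le_norm(2) [of f \<alpha> 0] by (simp add: log_bloch_norm_def)

text \<open>Differentiating the image series produces a factor n + 1 that cancels the decay of the
  moments and leaves ln(n)^\<beta>. Moving to the radius s = (1 + r) / 2 converts this into
  logw(r)^\<beta>, and the remaining sum of d_n s^n is at most B / (1 - s).\<close>

lemma hilbert_op_bounded_if_bloch:
  fixes d :: "nat \<Rightarrow> real"
  assumes \<alpha>: "\<alpha> > -1" and d: "\<And>n. d n \<ge> 0"
    and dser: "\<And>z. z \<in> ball 0 1 \<Longrightarrow> (\<lambda>n. complex_of_real (d n) * z ^ n) sums deriv g z"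
    and partial: "\<And>k. (\<Sum>n\<le>k. d n) \<le> B * real (k + 1)"
  shows "bounded_operator_log_bloch \<alpha> (\<alpha> + 1) (hilbert_op g)"
proof -
  define \<beta> where "\<beta> = \<alpha> + 1"
  have \<beta>: "\<beta> > 0"
    using \<alpha> by (simp add: \<beta>_def)
  obtain K where K: "K > 0" "\<And>f t. f \<in> log_bloch \<alpha> \<Longrightarrow> 0 \<le> t \<Longrightarrow> t < 1 \<Longrightarrow>
      norm (f (complex_of_real t)) \<le> K * log_bloch_norm \<alpha> f * logw t powr \<beta>"
    using log_bloch_growth [OF \<alpha>] unfolding \<beta>_def by blast
  obtain M where M: "M > 0"
    "\<And>n. set_integrable lborel {0..<1} (\<lambda>t. t ^ n * logw t powr \<beta>)"
    "\<And>n. (LBINT t:{0..<1}. t ^ n * logw t powr \<beta>) \<le> M * (1 + ln (real (n + 1))) powr \<beta> / real (n + 1)"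
    using logw_moment_upper [OF \<beta>] by blast
  obtain C where C: "C \<ge> 1" "\<And>x. x \<ge> 1 \<Longrightarrow> (1 + ln x) powr \<beta> \<le> C * sqrt x"
    using one_plus_ln_powr_le_sqrt [OF \<beta>] by blast
  have B: "B \<ge> 0"
    using partial [of 0] d [of 0] by simp
  \<comment> \<open>The first term bounds the value at 0. In the second, 32 = 2 * 4 * 2 * 2 collects
    1 - r^2 \<le> 2 (1 - r), the constant of \<open>log_weight_times_power_le\<close>, the index
    shift s^n \<le> 2 s^(n + 1), and 1 - s = (1 - r) / 2.\<close>
  define R where "R = d 0 * (K * M) + 32 * K * M * C * B * 2 powr \<beta>"
  have main: "hilbert_op g f \<in> log_bloch \<beta>"
    "log_bloch_norm \<beta> (hilbert_op g f) \<le> R * log_bloch_norm \<alpha> f"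
    if f: "f \<in> log_bloch \<alpha>" for f
  proof -
    define N where "N = log_bloch_norm \<alpha> f"
    have N: "N \<ge> 0"
      using f by (simp add: N_def log_bloch_norm_nonneg)
    define m where "m = (\<lambda>n. LINT t:{0..<1}|lborel. complex_of_real t ^ n * f (complex_of_real t))"
    have cont: "continuous_on (ball 0 1) f"
      using f by (auto simp: log_bloch_def intro: holomorphic_on_imp_continuous_on)
    have int: "set_integrable lborel {0..<1} (\<lambda>t. t ^ n * (K * N * logw t powr \<beta>))" for n
      using set_integrable_mult_right [of "K * N" lborel "{0..<1}" "\<lambda>t. t ^ n * logw t powr \<beta>"] M(2) [of n]
      by (simp add: mult_ac)
    have f_bound: "norm (f (complex_of_real t)) \<le> K * N * logw t powr \<beta>" if "0 \<le> t" "t < 1" for t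
      using K(2) [OF f that] by (simp add: N_def)
    have m_bound: "norm (m n) \<le> K * N * M * (1 + ln (real (n + 1))) powr \<beta> / real (n + 1)" for n
    proof -
      have "norm (m n) \<le> (LBINT t:{0..<1}. t ^ n * (K * N * logw t powr \<beta>))"
        unfolding m_def by (rule hilbert_op_power_series(2) [OF d dser cont int f_bound])
      also have "\<dots> = K * N * (LBINT t:{0..<1}. t ^ n * logw t powr \<beta>)"
        by (simp add: mult_ac flip: set_integral_mult_right)
      also have "\<dots> \<le> K * N * (M * (1 + ln (real (n + 1))) powr \<beta> / real (n + 1))"
        using K N by (intro mult_left_mono M) auto
      finally show ?thesis
        by (simp add: mult_ac)
    qed
    have h_ser: "(\<lambda>n. complex_of_real (d n) * m n * z ^ n) sums hilbert_op g f z" if "z \<in> ball 0 1" for z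
      unfolding m_def using that by (intro hilbert_op_power_series(1) [OF d dser cont int f_bound]) auto
    have quot: "bloch_quotient \<beta> (hilbert_op g f) z \<le> 32 * K * M * C * B * 2 powr \<beta> * N" if z: "z \<in> ball 0 1" for z
    proof -
      define r where "r = norm z"
      define s where "s = (1 + r) / 2"
      have r: "0 \<le> r" "r < 1"
        using z by (auto simp: r_def)
      have s: "1 / 2 \<le> s" "s < 1" "1 - s = (1 - r) / 2"
        using r by (auto simp: s_def field_simps)
      define A where "A = K * N * M * (4 * C * logw r powr \<beta>) * 2"
      have A: "A \<ge> 0"
        using K N M C by (simp add: A_def)
      define G where "G = norm (deriv g (of_real s))"
      have G: "(\<lambda>n. d n * s ^ n) sums G"
        unfolding G_def using s by (intro power_series_nonneg_on_reals d dser) auto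
      have G_Suc: "summable (\<lambda>n. d (Suc n) * s ^ Suc n)" "(\<Sum>n. d (Suc n) * s ^ Suc n) \<le> G"
        using G d [of 0] suminf_split_head [of "\<lambda>n. d n * s ^ n"] summable_Suc_iff [of "\<lambda>n. d n * s ^ n"]
        by (auto simp: sums_iff)
      have term_le: "norm (of_nat (Suc n) * (complex_of_real (d (Suc n)) * m (Suc n)) * z ^ n) \<le> A * (d (Suc n) * s ^ Suc n)" for n
      proof -
        have "norm (of_nat (Suc n) * (complex_of_real (d (Suc n)) * m (Suc n)) * z ^ n)
            = real (Suc n) * d (Suc n) * r ^ n * norm (m (Suc n))"
          using d [of "Suc n"] by (simp add: norm_mult norm_power r_def del: of_nat_Suc)
        also have "\<dots> \<le> real (n + 2) * d (Suc n) * r ^ n * (K * N * M * (1 + ln (real (Suc n + 1))) powr \<beta> / real (Suc n + 1))"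
          using d r m_bound [of "Suc n"] by (intro mult_mono mult_nonneg_nonneg) auto
        also have "\<dots> = d (Suc n) * (K * N * M) * ((1 + ln (real (n + 2))) powr \<beta> * r ^ n)"
          by (simp add: field_simps)
        also have "\<dots> \<le> d (Suc n) * (K * N * M) * (4 * C * logw r powr \<beta> * s ^ n)"
          unfolding s_def using d K N M
          by (intro mult_left_mono log_weight_times_power_le C \<beta> r) auto
        \<comment> \<open>As s \<ge> 1 / 2, one more power of s costs a factor 2 and aligns the
          exponent with the index of d.\<close>
        also have "\<dots> \<le> d (Suc n) * (K * N * M) * (4 * C * logw r powr \<beta> * (2 * s ^ Suc n))"
          using d K N M C s by (intro mult_left_mono) auto
        finally show ?thesis
          by (simp add: A_def mult_ac)
      qed
      have "norm (\<Sum>n. of_nat (Suc n) * (complex_of_real (d (Suc n)) * m (Suc n)) * z ^ n)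
          \<le> (\<Sum>n. A * (d (Suc n) * s ^ Suc n))"
        using G_Suc(1) by (intro norm_suminf_le term_le summable_mult)
      also have "\<dots> = A * (\<Sum>n. d (Suc n) * s ^ Suc n)"
        using G_Suc(1) by (rule suminf_mult)
      also have "\<dots> \<le> A * G"
        using A G_Suc(2) by (intro mult_left_mono)
      finally have deriv_le: "norm (deriv (hilbert_op g f) z) \<le> A * G"
        using holomorphic_of_power_series(2) [OF h_ser z] by (simp add: sums_iff)
      have "(1 - s) * G \<le> B"
        using s by (intro power_series_le_of_partial_sums [OF d partial _ s(2) G]) simp
      then have GB: "(1 - r) * G \<le> 2 * B"
        unfolding s(3) by simp
      have "1 - r\<^sup>2 = (1 + r) * (1 - r)"
        by (simp add: power2_eq_square algebra_simps)
      then have r2: "1 - r\<^sup>2 \<le> 2 * (1 - r)" "0 \<le> 1 - r\<^sup>2"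
        using r mult_right_mono [of "1 + r" 2 "1 - r"] by auto
      have L: "logw r \<ge> 1"
        using r by (rule logw_ge_1)
      have "bloch_quotient \<beta> (hilbert_op g f) z =
          (1 - r\<^sup>2) * logw (r\<^sup>2) powr (- \<beta>) * norm (deriv (hilbert_op g f) z)"
        using z by (simp add: bloch_quotient_eq_logw r_def)
      also have "\<dots> \<le> (2 * (1 - r)) * (2 powr \<beta> * logw r powr (- \<beta>)) * (A * G)"
        using r2 r deriv_le logw_square_powr_le [OF r, of "- \<beta>"] \<beta>
        by (intro mult_mono mult_nonneg_nonneg) auto
      also have "\<dots> = 16 * K * M * C * 2 powr \<beta> * N * ((1 - r) * G) * (logw r powr (- \<beta>) * logw r powr \<beta>)"
        by (simp add: A_def mult_ac)
      also have "\<dots> = 16 * K * M * C * 2 powr \<beta> * N * ((1 - r) * G)"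
        using L by (simp add: powr_minus)
      also have "\<dots> \<le> 16 * K * M * C * 2 powr \<beta> * N * (2 * B)"
        using GB K M C N by (intro mult_left_mono) auto
      finally show ?thesis
        by (simp add: mult_ac)
    qed
    show "hilbert_op g f \<in> log_bloch \<beta>"
      using holomorphic_of_power_series(1) [OF h_ser] quot by (auto simp: log_bloch_def intro!: bdd_aboveI2)
    have "(\<lambda>n. complex_of_real (d n) * m n * 0 ^ n) sums (complex_of_real (d 0) * m 0)"
      by (rule powser_sums_zero)
    then have "hilbert_op g f 0 = complex_of_real (d 0) * m 0"
      using h_ser [of 0] sums_unique2 by fastforce
    then have "norm (hilbert_op g f 0) \<le> d 0 * (K * N * M)"
      using m_bound [of 0] d [of 0] by (simp add: norm_mult mult_left_mono)
    moreover have "(SUP z\<in>ball 0 1. bloch_quotient \<beta> (hilbert_op g f) z) \<le> 32 * K * M * C * B * 2 powr \<beta> * N"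
      by (intro cSUP_least quot) auto
    ultimately have "log_bloch_norm \<beta> (hilbert_op g f) \<le> d 0 * (K * N * M) + 32 * K * M * C * B * 2 powr \<beta> * N"
      unfolding log_bloch_norm_def by linarith
    also have "\<dots> = R * N"
      by (simp add: R_def algebra_simps)
    finally show "log_bloch_norm \<beta> (hilbert_op g f) \<le> R * log_bloch_norm \<alpha> f"
      by (simp add: N_def)
  qed
  then show ?thesis
    by (auto simp: bounded_operator_log_bloch_def \<beta>_def)
qed

text \<open>It suffices to apply the operator to the test function, whose moments are as large as the growth
  of the space allows.\<close>

lemma bounded_hilbert_op_imp_log_sums:
  fixes d :: "nat \<Rightarrow> real"
  assumes \<alpha>: "\<alpha> > -1" and d: "\<And>n. d n \<ge> 0"
    and dser: "\<And>z. z \<in> ball 0 1 \<Longrightarrow> (\<lambda>n. complex_of_real (d n) * z ^ n) sums deriv g z"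
    and bounded: "bounded_operator_log_bloch \<alpha> (\<alpha> + 1) (hilbert_op g)"
  obtains B where "B \<ge> 0"
    "\<And>k. (\<Sum>n\<le>k. d (Suc n) * ln (real (n + 3)) powr (\<alpha> + 1))
      \<le> B * real (k + 1) * (1 + ln (real (2 * (k + 1)))) powr (\<alpha> + 1)"
proof -
  define \<beta> where "\<beta> = \<alpha> + 1"
  have \<beta>: "\<beta> > 0"
    using \<alpha> by (simp add: \<beta>_def)
  define f where "f = log_test \<beta>"
  define \<mu> where "\<mu> = (\<lambda>n. LBINT t:{0..<1}. t ^ n * logw t powr \<beta>)"
  define m where "m = (\<lambda>n. LINT t:{0..<1}|lborel. complex_of_real t ^ n * f (complex_of_real t))"
  define h where "h = hilbert_op g f"
  have f: "f \<in> log_bloch \<alpha>"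
    unfolding f_def \<beta>_def using \<alpha> by (rule log_test_in_log_bloch)
  have "h \<in> log_bloch \<beta>"
    using f bounded by (simp add: h_def bounded_operator_log_bloch_def \<beta>_def)
  then obtain B where B: "\<And>z. z \<in> ball 0 1 \<Longrightarrow> bloch_quotient \<beta> h z \<le> B"
    unfolding log_bloch_def bdd_above_def by blast
  have B0: "B \<ge> 0"
    using B [of 0] bloch_quotient_nonneg [of 0 \<beta> h] by simp
  have cont: "continuous_on (ball 0 1) f"
    using f by (auto simp: log_bloch_def intro: holomorphic_on_imp_continuous_on)
  have int: "set_integrable lborel {0..<1} (\<lambda>t. t ^ n * logw t powr \<beta>)" for n
    using logw_moment_upper [OF \<beta>] by blast
  have f_bound: "norm (f (complex_of_real t)) \<le> logw t powr \<beta>" if "0 \<le> t" "t < 1" for t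
    using that by (simp add: f_def log_test_of_real)
  have m: "m n = complex_of_real (\<mu> n)" for n
  proof -
    have "m n = (LINT t:{0..<1}|lborel. complex_of_real (t ^ n * logw t powr \<beta>))"
      unfolding m_def f_def by (intro set_lebesgue_integral_cong) (auto simp: log_test_of_real)
    then show ?thesis
      by (simp add: \<mu>_def set_integral_complex_of_real del: of_real_mult of_real_power)
  qed
  have h_ser: "(\<lambda>n. complex_of_real (d n) * m n * z ^ n) sums h z" if "z \<in> ball 0 1" for z
    unfolding h_def m_def using that
    by (intro hilbert_op_power_series(1) [OF d dser cont int f_bound]) auto
  define c where "c = (\<lambda>n. real (Suc n) * (d (Suc n) * \<mu> (Suc n)))"
  have c_ser: "(\<lambda>n. complex_of_real (c n) * z ^ n) sums deriv h z" if "z \<in> ball 0 1" for z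
    using holomorphic_of_power_series(2) [OF h_ser that] by (simp add: c_def m)
  have \<mu>: "(1 + ln (real (n + 1))) powr \<beta> / (2 * real (n + 1)) \<le> \<mu> n" for n
    unfolding \<mu>_def by (rule logw_moment_lower [OF \<beta>])
  \<comment> \<open>One factor 1 / 2 is that of the moment bound, the other is (n + 1) / (n + 2)
    \<ge> 1 / 2. The weight ln (n + 3) belongs to the coefficient of g with index n + 2.\<close>
  have c_lower: "d (Suc n) * ln (real (n + 3)) powr \<beta> / 4 \<le> c n" for n
  proof -
    have "ln (real (n + 3)) \<le> ln (2 * real (n + 2))"
      by (subst ln_le_cancel_iff) auto
    also have "\<dots> \<le> 1 + ln (real (n + 2))"
      using ln_le_minus_one [of "2::real"] by (subst ln_mult) auto
    finally have "ln (real (n + 3)) powr \<beta> \<le> (1 + ln (real (n + 2))) powr \<beta>"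
      using \<beta> by (intro powr_mono2) auto
    then have "1 / 2 * (ln (real (n + 3)) powr \<beta> / 2)
        \<le> real (Suc n) / real (n + 2) * ((1 + ln (real (n + 2))) powr \<beta> / 2)"
      by (intro mult_mono divide_right_mono) (auto simp: field_simps)
    also have "\<dots> = real (Suc n) * ((1 + ln (real (Suc n + 1))) powr \<beta> / (2 * real (Suc n + 1)))"
      by (simp add: field_simps)
    also have "\<dots> \<le> real (Suc n) * \<mu> (Suc n)"
      by (intro mult_left_mono \<mu>) auto
    finally have "d (Suc n) * (1 / 2 * (ln (real (n + 3)) powr \<beta> / 2)) \<le> d (Suc n) * (real (Suc n) * \<mu> (Suc n))"
      using d by (intro mult_left_mono)
    then show ?thesis
      by (simp add: c_def mult_ac)
  qed
  have c_nonneg: "c n \<ge> 0" for n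
    using c_lower [of n] d [of "Suc n"] by (smt (verit) divide_nonneg_pos mult_nonneg_nonneg powr_ge_zero)
  \<comment> \<open>16 = 4 * 2 * 2: the quarter in \<open>c_lower\<close>, the half lost in passing
    to partial sums, and 1 / (1 - r) = 2 (k + 1).\<close>
  have "(\<Sum>n\<le>k. d (Suc n) * ln (real (n + 3)) powr \<beta>)
      \<le> 16 * B * real (k + 1) * (1 + ln (real (2 * (k + 1)))) powr \<beta>" for k
  proof -
    define x where "x = 1 / (2 * real (k + 1))"
    define r where "r = 1 - x"
    have x: "0 < x" "x \<le> 1 / 2"
      by (auto simp: x_def field_simps)
    then have r: "0 \<le> r" "r < 1"
      by (auto simp: r_def)
    have L: "logw r = 1 + ln (real (2 * (k + 1)))"
      by (simp add: logw_def r_def x_def ln_div)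
    have L1: "logw r \<ge> 1"
      using r by (rule logw_ge_1)
    define H where "H = norm (deriv h (of_real r))"
    have "x * logw r powr (- \<beta>) * H \<le> (1 - r\<^sup>2) * logw (r\<^sup>2) powr (- \<beta>) * H"
    proof (intro mult_right_mono mult_mono)
      have "r\<^sup>2 \<le> r"
        using r by (simp add: power2_eq_square mult_left_le)
      then show "x \<le> 1 - r\<^sup>2" "0 \<le> 1 - r\<^sup>2"
        using x by (auto simp: r_def)
      have "r\<^sup>2 < 1"
        using r by (simp add: power_less_one_iff)
      then show "logw r powr (- \<beta>) \<le> logw (r\<^sup>2) powr (- \<beta>)"
        using logw_ge_1 [of "r\<^sup>2"] logw_square_le [OF r] \<beta> by (intro powr_mono2') auto
    qed (auto simp: H_def)
    also have "\<dots> \<le> B"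
      using B [of "of_real r"] r by (simp add: H_def bloch_quotient_eq_logw)
    finally have "H \<le> B * logw r powr \<beta> / x"
      using x L1 by (simp add: powr_minus field_simps)
    also have "\<dots> = 2 * B * real (k + 1) * logw r powr \<beta>"
      by (simp add: x_def)
    finally have H: "H \<le> 2 * B * real (k + 1) * logw r powr \<beta>" .
    have "(\<lambda>n. c n * r ^ n) sums H"
      unfolding H_def using r by (intro power_series_nonneg_on_reals c_nonneg c_ser) auto
    then have "(\<Sum>n\<le>k. c n) \<le> 2 * H"
      by (intro partial_sum_le_power_series c_nonneg) (simp add: r_def x_def)
    moreover have "(\<Sum>n\<le>k. d (Suc n) * ln (real (n + 3)) powr \<beta> / 4) \<le> (\<Sum>n\<le>k. c n)"
      by (intro sum_mono c_lower)
    ultimately show ?thesis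
      using H by (simp add: L flip: sum_divide_distrib)
  qed
  then show ?thesis
    using B0 by (intro that [of "16 * B"]) (auto simp: \<beta>_def)
qed

theorem theorem4p1:
  fixes g :: "complex \<Rightarrow> complex" and b :: "nat \<Rightarrow> real" and \<alpha> :: real
  assumes g_holomorphic: "g holomorphic_on ball 0 1"
    and g_series: "\<And>z. z \<in> ball 0 1 \<Longrightarrow> (\<lambda>n. complex_of_real (b n) * z ^ n) sums g z"
    and b_nonneg: "\<And>n. b n \<ge> 0"
    and alpha: "\<alpha> > -1"
  shows "(bounded_operator_log_bloch \<alpha> (\<alpha> + 1) (hilbert_op g) \<longleftrightarrow> g \<in> bloch) \<and>
    (g \<in> bloch \<longleftrightarrow>
      (\<lambda>N. \<Sum>n=1..N. real n * b n * ln (real (n + 1)) powr (\<alpha> + 1))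
        \<in> O[sequentially](\<lambda>N. real N * ln (real N) powr (\<alpha> + 1))) \<and>
    ((\<lambda>N. \<Sum>n=1..N. real n * b n * ln (real (n + 1)) powr (\<alpha> + 1))
        \<in> O[sequentially](\<lambda>N. real N * ln (real N) powr (\<alpha> + 1)) \<longleftrightarrow>
      (\<lambda>N. \<Sum>n=1..N. real n * b n) \<in> O[sequentially](\<lambda>N. real N))"
proof -
  define \<beta> where "\<beta> = \<alpha> + 1"
  have \<beta>: "\<beta> > 0"
    using alpha by (simp add: \<beta>_def)
  define a where "a = (\<lambda>n. real n * b n)"
  have a: "a n \<ge> 0" for n
    using b_nonneg by (simp add: a_def)
  define log_sums where "log_sums \<longleftrightarrow> (\<lambda>N. \<Sum>n=1..N. a n * ln (real (n + 1)) powr \<beta>)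
    \<in> O[sequentially](\<lambda>N. real N * ln (real N) powr \<beta>)"
  define linear_sums where "linear_sums \<longleftrightarrow> (\<lambda>N. \<Sum>n=1..N. a n) \<in> O[sequentially](\<lambda>N. real N)"
  define d where "d = (\<lambda>n. a (Suc n))"
  have d: "d n \<ge> 0" for n
    using a by (simp add: d_def)
  have dser: "(\<lambda>n. complex_of_real (d n) * z ^ n) sums deriv g z" if "z \<in> ball 0 1" for z
    using holomorphic_of_power_series(2) [OF g_series that] by (simp add: a_def d_def)
  obtain K where "\<And>x. x \<ge> 1 \<Longrightarrow> (1 + ln x) powr \<beta> \<le> K * sqrt x"
    using one_plus_ln_powr_le_sqrt [OF \<beta>] by blast
  then have 34: "log_sums \<longleftrightarrow> linear_sums"
    unfolding log_sums_def linear_sums_def by (intro weighted_sums_bigo_iff a \<beta>)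
  have 4: "linear_sums \<longleftrightarrow> (\<exists>C. \<forall>k. (\<Sum>n\<le>k. d n) \<le> C * real (k + 1))"
    unfolding linear_sums_def d_def by (intro sums_linear_bigo_iff a)
  have 24: "g \<in> bloch \<longleftrightarrow> linear_sums"
    unfolding 4 by (intro bloch_iff_partial_sums g_holomorphic d dser)
  have 41: "bounded_operator_log_bloch \<alpha> (\<alpha> + 1) (hilbert_op g)" if linear_sums
    using that hilbert_op_bounded_if_bloch [OF alpha d dser] unfolding 4 by blast
  have 13: log_sums if bounded: "bounded_operator_log_bloch \<alpha> (\<alpha> + 1) (hilbert_op g)"
  proof -
    obtain B where B: "B \<ge> 0" "\<And>k. (\<Sum>n\<le>k. d (Suc n) * ln (real (n + 3)) powr \<beta>)
        \<le> B * real (k + 1) * (1 + ln (real (2 * (k + 1)))) powr \<beta>"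
      using bounded_hilbert_op_imp_log_sums [OF alpha d dser bounded] unfolding \<beta>_def by blast
    show ?thesis
      unfolding log_sums_def
    proof (rule bigoI)
      \<comment> \<open>The derivative of the image does not see the constant term, so the summand n
        = 1 is bounded separately by \<open>a 1\<close>. The 3 comes from 1 + ln (2 (k + 1)) \<le> 3
        ln N, which uses ln N \<ge> 1 and hence N \<ge> 3 \<ge> e.\<close>
      show "\<forall>\<^sub>F N in sequentially. norm (\<Sum>n=1..N. a n * ln (real (n + 1)) powr \<beta>)
          \<le> (a 1 + B * 3 powr \<beta>) * norm (real N * ln (real N) powr \<beta>)"
        using eventually_ge_at_top [of 3]
      proof eventually_elim
        case (elim N)
        define k where "k = N - 2"
        have N: "N = Suc (Suc k)"
          using elim by (simp add: k_def)
        have "exp 1 \<le> real N"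
          using exp_le elim by linarith
        then have lnN: "1 \<le> ln (real N)"
          using elim by (subst ln_ge_iff) auto
        have "(\<Sum>n=1..N. a n * ln (real (n + 1)) powr \<beta>)
            = (\<Sum>n\<le>Suc k. a (Suc n) * ln (real (n + 2)) powr \<beta>)"
          by (simp only: N One_nat_def sum.atLeast_Suc_atMost_Suc_shift o_def atMost_atLeast0) simp
        also have "\<dots> = a 1 * ln 2 powr \<beta> + (\<Sum>n\<le>k. d (Suc n) * ln (real (n + 3)) powr \<beta>)"
          by (simp add: sum.atMost_Suc_shift d_def add_ac del: sum.atMost_Suc)
        also have "a 1 * ln 2 powr \<beta> \<le> a 1 * (real N * ln (real N) powr \<beta>)"
        proof (rule mult_left_mono [OF _ a])
          have "ln 2 powr \<beta> \<le> ln (real N) powr \<beta>"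
            using elim \<beta> by (intro powr_mono2) auto
          also have "\<dots> \<le> real N * ln (real N) powr \<beta>"
            using elim by simp
          finally show "ln 2 powr \<beta> \<le> real N * ln (real N) powr \<beta>" .
        qed
        also have "(\<Sum>n\<le>k. d (Suc n) * ln (real (n + 3)) powr \<beta>)
            \<le> B * real (k + 1) * (1 + ln (real (2 * (k + 1)))) powr \<beta>"
          by (rule B)
        also have "\<dots> \<le> B * real N * (3 * ln (real N)) powr \<beta>"
        proof (intro mult_mono powr_mono2)
          have "ln (real (2 * (k + 1))) = ln 2 + ln (real (k + 1))"
            unfolding of_nat_mult by (subst ln_mult) auto
          also have "\<dots> \<le> 1 + ln (real N)"
            using ln_le_minus_one [of "2::real"] by (intro add_mono) (auto simp: N)
          finally show "1 + ln (real (2 * (k + 1))) \<le> 3 * ln (real N)"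
            using lnN by linarith
        qed (use B \<beta> N in auto)
        also have "\<dots> = B * 3 powr \<beta> * (real N * ln (real N) powr \<beta>)"
          using lnN by (simp add: powr_mult)
        finally have "(\<Sum>n=1..N. a n * ln (real (n + 1)) powr \<beta>)
            \<le> (a 1 + B * 3 powr \<beta>) * (real N * ln (real N) powr \<beta>)"
          by (simp add: algebra_simps)
        moreover have "0 \<le> (\<Sum>n=1..N. a n * ln (real (n + 1)) powr \<beta>)"
          by (intro sum_nonneg mult_nonneg_nonneg a) auto
        ultimately show ?case
          by simp
      qed
    qed
  qed
  \<comment> \<open>The implications from (4) to (1) and from (1) to (3) close the cycle through the
    equivalences of (3) and (2) with (4).\<close>
  show ?thesis
    using 13 24 34 41 unfolding log_sums_def linear_sums_def a_def \<beta>_def by blast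
qed

end
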